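(* There exists an effective transformation $f:\mathbb{Q}\times\{0,1\}^\infty\times\{0,1\}^\infty\to\{0,1\}^\infty$ with the following property: if $\tau\in\mathbb{Q}\cap(0,1]$ and $x,y\in\{0,1\}^\infty$ are independent sequences that both have randomness rate $\tau$, then for every $\delta>0$ the sequence $f(\tau,x,y)$ has randomness rate $1-\delta$. Moreover, $f$ is a truth-table reduction.
   Context: Strings are finite binary strings, sequences are elements of $\{0,1\}^\infty$. For a string or sequence $x$, $x(n)$ is its $n$-th bit (indexing from 1) and $x(n_1:n_2)=x(n_1)x(n_1+1)\cdots x(n_2)$; juxtaposition $uv$ denotes concatenation. $K(u)$ is the plain Kolmogorov complexity of a string $u$ with respect to a fixed universal Turing machine $U$: $K(u)=\min\{|p|: U(p)=u\}$. A sequence $x$ has randomness rate $\sigma\in[0,1]$ if $K(x(1:n))\ge \sigma n$ for all but finitely many $n$. Two sequences $x,y$ are independent if there is a constant $c$ such that for all natural numbers $n,m\ge 1$, $K(x(1:n)y(1:m))\ge K(x(1:n))+K(y(1:m))-c(1+\log n+\log m)$. An effective transformation $f$ is given by a Turing machine $M_f$ with access to two oracles $x,y\in\{0,1\}^\infty$ (a query returns $x(n)$ or $y(n)$); on input $(\tau,1^n)$, $\tau$ a rational in canonical representation, it outputs one bit, and $f(\tau,x,y)=z$ means that for every $n$, $M_f$ on input $(\tau,1^n)$ with oracles $x,y$ halts and outputs $z(n)$. $f$ is a truth-table reduction if $M_f$ halts on all inputs with all oracles. *)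

theory Defs
  imports Complex_Main "HOL-Library.Nat_Bijection"
begin

text \<open>Kleene-style partial recursive function terms, extended with oracle calls.
  By the Church--Turing thesis (relativised), oracle Turing machines and these terms
  compute the same partial functions.\<close>

datatype recf =
    Zero
  | Succ
  | Proj nat
  | Comp recf "recf list"
  | Prim recf recf
  | Mu recf
  | Oracle nat

inductive eval :: "(nat \<Rightarrow> nat) list \<Rightarrow> recf \<Rightarrow> nat list \<Rightarrow> nat \<Rightarrow> bool" where
  eval_zero: "eval os Zero xs 0"
| eval_succ: "eval os Succ (x # xs) (Suc x)"
| eval_proj: "i < length xs \<Longrightarrow> eval os (Proj i) xs (xs ! i)"
| eval_comp: "length ys = length gs \<Longrightarrow> (\<forall>i < length gs. eval os (gs ! i) xs (ys ! i))
              \<Longrightarrow> eval os f ys z \<Longrightarrow> eval os (Comp f gs) xs z"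
| eval_prim0: "eval os f xs y \<Longrightarrow> eval os (Prim f g) (0 # xs) y"
| eval_primS: "eval os (Prim f g) (n # xs) y \<Longrightarrow> eval os g (n # y # xs) z
              \<Longrightarrow> eval os (Prim f g) (Suc n # xs) z"
| eval_mu: "eval os f (n # xs) 0 \<Longrightarrow> (\<forall>k < n. \<exists>v. eval os f (k # xs) (Suc v))
              \<Longrightarrow> eval os (Mu f) xs n"
| eval_oracle: "i < length os \<Longrightarrow> eval os (Oracle i) (k # xs) ((os ! i) k)"

text \<open>Strings are bool lists (True = 1). Sequences are functions nat => bool,
  0-indexed: the paper's bit x(n) (n >= 1) is x (n - 1).\<close>

fun bstr_code :: "bool list \<Rightarrow> nat" where
  "bstr_code [] = 0"
| "bstr_code (b # w) = 2 * bstr_code w + (if b then 2 else 1)"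

definition prefix :: "(nat \<Rightarrow> bool) \<Rightarrow> nat \<Rightarrow> bool list" where
  "prefix x n = map x [0..<n]"

definition bit_val :: "bool \<Rightarrow> nat" where
  "bit_val b = (if b then 1 else 0)"

definition seq_oracle :: "(nat \<Rightarrow> bool) \<Rightarrow> nat \<Rightarrow> nat" where
  "seq_oracle x k = (if k = 0 then 0 else bit_val (x (k - 1)))"

definition rat_code :: "rat \<Rightarrow> nat" where
  "rat_code q = (let (a, b) = quotient_of q in prod_encode (int_encode a, int_encode b))"

definition partial_computable :: "(bool list \<Rightarrow> bool list option) \<Rightarrow> bool" where
  "partial_computable V \<longleftrightarrow>
     (\<exists>r. \<forall>w v. V w = Some v \<longleftrightarrow> eval [] r [bstr_code w] (bstr_code v))"

definition universal_machine :: "(bool list \<Rightarrow> bool list option) \<Rightarrow> bool" where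
  "universal_machine U \<longleftrightarrow> partial_computable U \<and>
     (\<forall>V. partial_computable V \<longrightarrow>
        (\<exists>c. \<forall>p v. V p = Some v \<longrightarrow> (\<exists>q. U q = Some v \<and> length q \<le> length p + c)))"

definition KC :: "(bool list \<Rightarrow> bool list option) \<Rightarrow> bool list \<Rightarrow> nat" where
  "KC U u = (LEAST n. \<exists>p. length p = n \<and> U p = Some u)"

definition randomness_rate :: "(bool list \<Rightarrow> bool list option) \<Rightarrow> real \<Rightarrow> (nat \<Rightarrow> bool) \<Rightarrow> bool" where
  "randomness_rate U \<sigma> x \<longleftrightarrow> (\<forall>\<^sub>F n in sequentially. real (KC U (prefix x n)) \<ge> \<sigma> * real n)"

definition independent :: "(bool list \<Rightarrow> bool list option) \<Rightarrow> (nat \<Rightarrow> bool) \<Rightarrow> (nat \<Rightarrow> bool) \<Rightarrow> bool" where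
  "independent U x y \<longleftrightarrow> (\<exists>c::real. \<forall>n m. n \<ge> 1 \<longrightarrow> m \<ge> 1 \<longrightarrow>
      real (KC U (prefix x n @ prefix y m))
        \<ge> real (KC U (prefix x n)) + real (KC U (prefix y m)) - c * (1 + log 2 n + log 2 m))"

text \<open>M computes z = f(tau, x, y): on input (tau, 1^n) (encoded as the argument list
  [rat_code tau, n]) with oracles x, y, M halts with output z(n), for every n >= 1.\<close>
definition transforms :: "recf \<Rightarrow> rat \<Rightarrow> (nat \<Rightarrow> bool) \<Rightarrow> (nat \<Rightarrow> bool) \<Rightarrow> (nat \<Rightarrow> bool) \<Rightarrow> bool" where
  "transforms M \<tau> x y z \<longleftrightarrow>
     (\<forall>n \<ge> 1. eval [seq_oracle x, seq_oracle y] M [rat_code \<tau>, n] (bit_val (z (n - 1))))"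

definition truth_table :: "recf \<Rightarrow> bool" where
  "truth_table M \<longleftrightarrow> (\<forall>x y \<tau> n. \<exists>v. eval [seq_oracle x, seq_oracle y] M [rat_code \<tau>, n] v)"

end

theory Submission
  imports Defs "HOL-Library.FuncSet" "HOL-Real_Asymp.Real_Asymp"
begin

text \<open>
  The extractor ignores \<open>\<tau>\<close>. For \<open>R = 2 ^ 2 ^ i\<close> the output bits with positions in \<open>[\<surd>R, R)\<close> are read
  off the value at \<open>(x\<restriction>R\<^sup>2, y\<restriction>R\<^sup>2)\<close> of a table of \<open>R\<close>-bit numbers in which no value is taken too often
  on any rectangle with sides of size \<open>8 ^ R\<close>. A union bound shows that such tables exist, so the
  first one can be found by search. Since \<open>3 R\<close> is eventually below \<open>\<tau> R\<^sup>2\<close>, every positive rate is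
  enough.

  Let \<open>R \<le> n < R\<^sup>2\<close> and \<open>k\<^sub>1\<close>, \<open>k\<^sub>2\<close> be the complexities of the prefixes \<open>X\<close>, \<open>Y\<close> of length \<open>R ^ 4\<close>. Given a
  program for \<open>z\<restriction>n\<close>, the pair \<open>(X, Y)\<close> is found by its index among the pairs of strings of complexity
  at most \<open>k\<^sub>1\<close>, \<open>k\<^sub>2\<close> that are mapped to the bits \<open>\<surd>R, \<dots>, n - 1\<close> of \<open>z\<close>. These bits come from two
  blocks: the table for \<open>R\<close> sees only the prefixes of length \<open>R\<^sup>2\<close> of \<open>X\<close> and \<open>Y\<close>, and the table for
  \<open>R\<^sup>2\<close> sees all of \<open>X\<close> and \<open>Y\<close>. A prefix of \<open>X\<close> of large complexity has few extensions of complexity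
  at most \<open>k\<^sub>1\<close>, and strings with more extensions can be dropped from the enumeration. Hence the number
  of such pairs is at most \<open>2 ^ (k\<^sub>1 + k\<^sub>2 - n + \<surd>R + O(1))\<close>, and independence of \<open>x\<close> and \<open>y\<close> forces the
  complexity of \<open>z\<restriction>n\<close> to be at least \<open>n - \<surd>n - O(log n)\<close>.
\<close>

section \<open>Recursive functions\<close>

lemma eval_deterministic: "eval os r xs v \<Longrightarrow> eval os r xs w \<Longrightarrow> v = w"
proof (induction arbitrary: w rule: eval.induct)
  case (eval_comp ys gs os xs f z)
  from eval_comp.prems obtain ys' where ys': "length ys' = length gs"
    "\<forall>i<length gs. eval os (gs ! i) xs (ys' ! i)" "eval os f ys' w"
    by (cases rule: eval.cases) auto
  have "ys = ys'"
    using eval_comp.IH(1) eval_comp.hyps ys' by (intro nth_equalityI) auto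
  with ys' eval_comp.IH show ?case by blast
next
  case (eval_prim0 os f xs y g)
  from eval_prim0.prems show ?case
    by (cases rule: eval.cases) (auto intro: eval_prim0.IH)
next
  case (eval_primS os f g n xs y z)
  from eval_primS.prems show ?case
    by (cases rule: eval.cases) (use eval_primS.IH in auto)
next
  case (eval_mu os f n xs)
  from eval_mu.prems obtain "eval os f (w # xs) 0" "\<forall>k<w. \<exists>v. eval os f (k # xs) (Suc v)"
    by (cases rule: eval.cases) auto
  moreover have "\<not> n < w" "\<not> w < n"
    using calculation eval_mu.IH by (metis nat.distinct(1))+
  ultimately show ?case by linarith
qed (auto elim: eval.cases)

text \<open>One term has to work for all oracle lists, so the same function can serve decoders,
  which run with \<open>[]\<close>, and the extractor, which runs with two sequences as
  oracles.\<close>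

definition recursive :: "nat \<Rightarrow> (nat list \<Rightarrow> nat) \<Rightarrow> bool" where
  "recursive k f \<longleftrightarrow> (\<exists>r. \<forall>os xs. length xs = k \<longrightarrow> eval os r xs (f xs))"

definition decidable :: "nat \<Rightarrow> (nat list \<Rightarrow> bool) \<Rightarrow> bool" where
  "decidable k P \<longleftrightarrow> recursive k (\<lambda>xs. of_bool (P xs))"

named_theorems rec_intros

lemma recursive_cong:
  "recursive k f \<Longrightarrow> (\<And>xs. length xs = k \<Longrightarrow> f xs = g xs) \<Longrightarrow> recursive k g"
  unfolding recursive_def by metis

lemma recursive_comp:
  assumes "recursive (length gs) f" "\<And>g. g \<in> set gs \<Longrightarrow> recursive k g"
  shows "recursive k (\<lambda>xs. f (map (\<lambda>g. g xs) gs))"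
proof -
  from assms(1) obtain r where r: "\<And>os xs. length xs = length gs \<Longrightarrow> eval os r xs (f xs)"
    unfolding recursive_def by blast
  from assms(2) obtain R where R: "\<And>g os xs. g \<in> set gs \<Longrightarrow> length xs = k \<Longrightarrow> eval os (R g) xs (g xs)"
    unfolding recursive_def by metis
  have "eval os (Comp r (map R gs)) xs (f (map (\<lambda>g. g xs) gs))" if "length xs = k" for os xs
    by (rule eval.eval_comp[where ys = "map (\<lambda>g. g xs) gs"]) (auto intro: r R that)
  then show ?thesis unfolding recursive_def by blast
qed

lemma recursive_proj: "i < k \<Longrightarrow> recursive k (\<lambda>xs. xs ! i)"
  unfolding recursive_def by (rule exI[of _ "Proj i"]) (auto intro: eval.eval_proj)

lemma recursive_apply1:
  assumes "recursive 1 (\<lambda>ys. h (ys ! 0))" "recursive k f"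
  shows "recursive k (\<lambda>xs. h (f xs))"
  using recursive_comp[of "[f]" "\<lambda>ys. h (ys ! 0)" k] assms by simp

lemma recursive_apply2:
  assumes "recursive 2 (\<lambda>ys. h (ys ! 0) (ys ! 1))" "recursive k f" "recursive k g"
  shows "recursive k (\<lambda>xs. h (f xs) (g xs))"
  using recursive_comp[of "[f, g]" "\<lambda>ys. h (ys ! 0) (ys ! 1)" k] assms
  by (auto simp: numeral_2_eq_2)

lemma recursive_apply3:
  assumes "recursive 3 (\<lambda>ys. h (ys ! 0) (ys ! 1) (ys ! 2))" "recursive k f" "recursive k g" "recursive k l"
  shows "recursive k (\<lambda>xs. h (f xs) (g xs) (l xs))"
  using recursive_comp[of "[f, g, l]" "\<lambda>ys. h (ys ! 0) (ys ! 1) (ys ! 2)" k] assms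
  by (auto simp: numeral_3_eq_3)

lemma recursive_apply4:
  assumes "recursive 4 (\<lambda>ys. h (ys ! 0) (ys ! 1) (ys ! 2) (ys ! 3))"
    "recursive k f" "recursive k g" "recursive k l" "recursive k m"
  shows "recursive k (\<lambda>xs. h (f xs) (g xs) (l xs) (m xs))"
  using recursive_comp[of "[f, g, l, m]" "\<lambda>ys. h (ys ! 0) (ys ! 1) (ys ! 2) (ys ! 3)" k] assms
  by (auto simp: eval_nat_numeral)

lemma recursive_apply5:
  assumes "recursive 5 (\<lambda>ys. h (ys ! 0) (ys ! 1) (ys ! 2) (ys ! 3) (ys ! 4))"
    "recursive k f" "recursive k g" "recursive k l" "recursive k m" "recursive k n"
  shows "recursive k (\<lambda>xs. h (f xs) (g xs) (l xs) (m xs) (n xs))"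
  using recursive_comp[of "[f, g, l, m, n]" "\<lambda>ys. h (ys ! 0) (ys ! 1) (ys ! 2) (ys ! 3) (ys ! 4)" k] assms
  by (auto simp: eval_nat_numeral)

section \<open>Closure under arithmetic, bounded sums and bounded quantifiers\<close>

lemma recursive_Suc [rec_intros]:
  assumes "recursive k f"
  shows "recursive k (\<lambda>xs. Suc (f xs))"
proof (rule recursive_apply1[OF _ assms])
  have "eval os Succ xs (Suc (xs ! 0))" if "length xs = 1" for os xs
    using that by (cases xs) (auto intro: eval.eval_succ)
  then show "recursive 1 (\<lambda>ys. Suc (ys ! 0))"
    unfolding recursive_def by blast
qed

lemma recursive_const [rec_intros]: "recursive k (\<lambda>xs. c)"
proof (induction c)
  case 0
  show ?case unfolding recursive_def by (rule exI[of _ Zero]) (auto intro: eval.eval_zero)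
qed (rule recursive_Suc)

text \<open>Binders such as \<open>\<Sum>j<n\<close> and \<open>\<exists>j<n\<close> push their variable onto the argument list, so an outer
  argument \<open>xs ! i\<close> occurs as \<open>tl (\<dots> (tl ys)) ! i\<close> below nested binders.\<close>

lemma recursive_proj_tl: "i + d < k \<Longrightarrow> recursive k (\<lambda>xs. (tl ^^ d) xs ! i)"
proof (rule recursive_cong[OF recursive_proj])
  have drop: "(tl ^^ d) xs = drop d xs" for xs :: "nat list"
    by (induction d) (auto simp: drop_Suc tl_drop)
  show "xs ! (i + d) = (tl ^^ d) xs ! i" if "i + d < k" "length xs = k" for xs :: "nat list"
    unfolding drop using that by (simp add: add.commute)
qed

lemmas [rec_intros] =
  recursive_proj
  recursive_proj_tl[where d = "Suc 0", simplified]
  recursive_proj_tl[where d = "Suc (Suc 0)", simplified]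
  recursive_proj_tl[where d = "Suc (Suc (Suc 0))", simplified]
  recursive_proj_tl[where d = "Suc (Suc (Suc (Suc 0)))", simplified]
  recursive_proj_tl[where d = "Suc (Suc (Suc (Suc (Suc 0))))", simplified]
  recursive_proj_tl[where d = "Suc (Suc (Suc (Suc (Suc (Suc 0)))))", simplified]
  recursive_proj_tl[where d = "Suc (Suc (Suc (Suc (Suc (Suc (Suc 0))))))", simplified]

text \<open>\<open>Prim\<close> recurses on its first argument and hands on the others, so the bound
  \<open>b xs\<close> is computed first and put in front of the projections of
  \<open>xs\<close>.\<close>

lemma recursive_rec_nat:
  assumes "recursive k b" "recursive k f" "recursive (Suc (Suc k)) (\<lambda>ys. g (ys ! 0) (ys ! 1) (tl (tl ys)))"
  shows "recursive k (\<lambda>xs. rec_nat (f xs) (\<lambda>n y. g n y xs) (b xs))"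
proof -
  from assms obtain rb rf rg where
    rb: "\<And>os xs. length xs = k \<Longrightarrow> eval os rb xs (b xs)" and
    rf: "\<And>os xs. length xs = k \<Longrightarrow> eval os rf xs (f xs)" and
    rg: "\<And>os ys. length ys = Suc (Suc k) \<Longrightarrow> eval os rg ys (g (ys ! 0) (ys ! 1) (tl (tl ys)))"
    unfolding recursive_def by blast
  have prim: "eval os (Prim rf rg) (n # xs) (rec_nat (f xs) (\<lambda>n y. g n y xs) n)"
    if "length xs = k" for os xs n
  proof (induction n)
    case 0
    show ?case by (simp add: eval.eval_prim0 rf that)
  next
    case (Suc n)
    show ?case
      using eval.eval_primS[OF Suc] rg[of "n # _ # xs" os] that by auto
  qed
  have "eval os (Comp (Prim rf rg) (rb # map Proj [0..<k])) xs (rec_nat (f xs) (\<lambda>n y. g n y xs) (b xs))"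
    if "length xs = k" for os xs
  proof (rule eval.eval_comp[where ys = "b xs # xs"])
    show "\<forall>i<length (rb # map Proj [0..<k]). eval os ((rb # map Proj [0..<k]) ! i) xs ((b xs # xs) ! i)"
      using that by (auto simp: nth_Cons rb eval.eval_proj split: nat.splits)
  qed (use that prim in auto)
  then show ?thesis unfolding recursive_def by blast
qed

lemma recursive_add [rec_intros]:
  assumes "recursive k f" "recursive k g"
  shows "recursive k (\<lambda>xs. f xs + g xs)"
proof (rule recursive_cong)
  show "recursive k (\<lambda>xs. rec_nat (f xs) (\<lambda>n y. Suc y) (g xs))"
    by (intro recursive_rec_nat assms rec_intros) simp
next
  fix xs
  show "rec_nat (f xs) (\<lambda>n y. Suc y) (g xs) = f xs + g xs"
    by (induction "g xs" arbitrary: g) (metis add.right_neutral old.nat.simps(6), metis add_Suc_right old.nat.simps(7))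
qed

text \<open>Bounded sums take the place of bounded search: bounded quantifiers, division and the
  decoding of pairs are reduced to them.\<close>

lemma recursive_sum [rec_intros]:
  assumes "recursive k b" "recursive (Suc k) (\<lambda>ys. f (ys ! 0) (tl ys))"
  shows "recursive k (\<lambda>xs. \<Sum>j<b xs. f j xs)"
proof (rule recursive_cong)
  have "recursive (Suc (Suc k)) (\<lambda>ys. f (ys ! 0) (tl (tl ys)))"
  proof (rule recursive_cong)
    \<comment> \<open>Entry 1 is the accumulator of the recursion and is left out of the arguments
      of \<open>f\<close>.\<close>
    let ?gs = "(\<lambda>ys. ys ! 0) # map (\<lambda>i ys. ys ! Suc (Suc i)) [0..<k]"
    show "recursive (Suc (Suc k)) (\<lambda>ys. (\<lambda>zs. f (zs ! 0) (tl zs)) (map (\<lambda>g. g ys) ?gs))"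
      by (rule recursive_comp) (use assms(2) in \<open>auto intro: rec_intros\<close>)
    fix ys :: "nat list"
    assume "length ys = Suc (Suc k)"
    then have "map ((\<lambda>g. g ys) \<circ> (\<lambda>i ys. ys ! Suc (Suc i))) [0..<k] = tl (tl ys)"
      by (intro nth_equalityI) (auto simp: nth_tl)
    then show "(\<lambda>zs. f (zs ! 0) (tl zs)) (map (\<lambda>g. g ys) ?gs) = f (ys ! 0) (tl (tl ys))"
      by simp
  qed
  then show "recursive k (\<lambda>xs. rec_nat 0 (\<lambda>n y. y + f n xs) (b xs))"
    by (intro recursive_rec_nat assms rec_intros) auto
next
  have "rec_nat 0 (\<lambda>n y. y + f n xs) m = (\<Sum>j<m. f j xs)" for m xs
    by (induction m) auto
  then show "rec_nat 0 (\<lambda>n y. y + f n xs) (b xs) = (\<Sum>j<b xs. f j xs)" for xs .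
qed

lemma recursive_mult [rec_intros]:
  assumes "recursive k f" "recursive k g"
  shows "recursive k (\<lambda>xs. f xs * g xs)"
proof (rule recursive_apply2[OF _ assms, where h = "(*)"])
  have "recursive 2 (\<lambda>xs. \<Sum>j<xs ! 0. xs ! 1)"
    by (intro rec_intros) auto
  then show "recursive 2 (\<lambda>ys. ys ! 0 * ys ! 1)" by simp
qed

lemma recursive_diff [rec_intros]:
  assumes "recursive k f" "recursive k g"
  shows "recursive k (\<lambda>xs. f xs - g xs)"
proof (rule recursive_apply2[OF _ assms, where h = "(-)"])
  \<comment> \<open>The inner recursion \<open>rec_nat 0 (\<lambda>m _. m)\<close> is the
    predecessor function.\<close>
  have "recursive 2 (\<lambda>xs. rec_nat (xs ! 0) (\<lambda>n y. rec_nat 0 (\<lambda>m _. m) y) (xs ! 1))"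
    by (intro recursive_rec_nat rec_intros) auto
  moreover have "rec_nat a (\<lambda>n y. rec_nat 0 (\<lambda>m _. m) y) b = a - b" for a b :: nat
  proof (induction b)
    case (Suc b)
    then show ?case by (cases "a - b") auto
  qed simp
  ultimately show "recursive 2 (\<lambda>ys. ys ! 0 - ys ! 1)" by simp
qed

lemma recursive_power [rec_intros]:
  assumes "recursive k f" "recursive k g"
  shows "recursive k (\<lambda>xs. f xs ^ g xs)"
proof (rule recursive_apply2[OF _ assms, where h = "(^)"])
  have "recursive 2 (\<lambda>xs. rec_nat 1 (\<lambda>n y. xs ! 0 * y) (xs ! 1))"
    by (intro recursive_rec_nat rec_intros) auto
  moreover have "rec_nat 1 (\<lambda>n y. a * y) b = a ^ b" for a b :: nat
    by (induction b) auto
  ultimately show "recursive 2 (\<lambda>ys. ys ! 0 ^ ys ! 1)" by simp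
qed

lemma recursive_of_bool [rec_intros]: "decidable k P \<Longrightarrow> recursive k (\<lambda>xs. of_bool (P xs))"
  by (simp add: decidable_def)

lemma decidable_le [rec_intros]:
  assumes "recursive k f" "recursive k g"
  shows "decidable k (\<lambda>xs. f xs \<le> g xs)"
  unfolding decidable_def
proof (rule recursive_cong)
  show "recursive k (\<lambda>xs. 1 - (f xs - g xs))"
    by (intro rec_intros assms)
qed auto

lemma decidable_not [rec_intros]:
  assumes "decidable k P"
  shows "decidable k (\<lambda>xs. \<not> P xs)"
  unfolding decidable_def
proof (rule recursive_cong)
  show "recursive k (\<lambda>xs. 1 - of_bool (P xs))"
    by (intro rec_intros assms)
qed auto

lemma decidable_conj [rec_intros]:
  assumes "decidable k P" "decidable k Q"
  shows "decidable k (\<lambda>xs. P xs \<and> Q xs)"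
  unfolding decidable_def
proof (rule recursive_cong)
  show "recursive k (\<lambda>xs. of_bool (P xs) * of_bool (Q xs))"
    by (intro rec_intros assms)
qed auto

lemma decidable_imp [rec_intros]:
  assumes "decidable k P" "decidable k Q"
  shows "decidable k (\<lambda>xs. P xs \<longrightarrow> Q xs)"
  using decidable_not[OF decidable_conj[OF assms(1) decidable_not[OF assms(2)]]] by simp

lemma decidable_less [rec_intros]:
  assumes "recursive k f" "recursive k g"
  shows "decidable k (\<lambda>xs. f xs < g xs)"
  using decidable_not[OF decidable_le[OF assms(2,1)]] by (simp add: not_le)

lemma decidable_eq [rec_intros]:
  assumes "recursive k f" "recursive k g"
  shows "decidable k (\<lambda>xs. f xs = g xs)"
  using decidable_conj[OF decidable_le[OF assms] decidable_le[OF assms(2,1)]] by (simp add: eq_iff)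

lemma decidable_ex [rec_intros]:
  assumes "recursive k b" "decidable (Suc k) (\<lambda>ys. P (ys ! 0) (tl ys))"
  shows "decidable k (\<lambda>xs. \<exists>j<b xs. P j xs)"
proof -
  have "decidable k (\<lambda>xs. (0::nat) < (\<Sum>j<b xs. of_bool (P j xs)))"
    by (intro rec_intros assms)
  moreover have "0 < (\<Sum>j<b xs. (of_bool (P j xs) :: nat)) \<longleftrightarrow> (\<exists>j<b xs. P j xs)" for xs
    by (auto simp: zero_less_iff_neq_zero)
  ultimately show ?thesis by simp
qed

lemma decidable_all [rec_intros]:
  assumes "recursive k b" "decidable (Suc k) (\<lambda>ys. P (ys ! 0) (tl ys))"
  shows "decidable k (\<lambda>xs. \<forall>j<b xs. P j xs)"
  using decidable_not[OF decidable_ex[OF assms(1) decidable_not[OF assms(2)]]] by simp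

lemma recursive_if [rec_intros]:
  assumes "decidable k P" "recursive k f" "recursive k g"
  shows "recursive k (\<lambda>xs. if P xs then f xs else g xs)"
proof (rule recursive_cong)
  show "recursive k (\<lambda>xs. of_bool (P xs) * f xs + (1 - of_bool (P xs)) * g xs)"
    by (intro rec_intros assms)
qed auto

lemma recursive_div [rec_intros]:
  assumes "recursive k f" "recursive k g"
  shows "recursive k (\<lambda>xs. f xs div g xs)"
proof (rule recursive_apply2[OF _ assms, where h = "(div)"])
  \<comment> \<open>The quotient counts the positive multiples of the divisor up to the dividend;
    the guard yields 0 for division by zero.\<close>
  have "recursive 2 (\<lambda>xs. \<Sum>j<xs ! 0. of_bool (0 < xs ! 1 \<and> Suc j * xs ! 1 \<le> xs ! 0))"
    by (intro rec_intros) auto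
  moreover have "(\<Sum>j<m. of_bool (0 < n \<and> Suc j * n \<le> m)) = m div n" for m n :: nat
  proof (cases "n = 0")
    case False
    have "Suc j * n \<le> m \<longleftrightarrow> j < m div n" for j
      using False less_eq_div_iff_mult_less_eq[of n "Suc j" m] by (simp add: Suc_le_eq)
    then have "{j. j < m \<and> Suc j * n \<le> m} = {..<m div n}"
      using order.strict_trans2[OF _ div_le_dividend] by blast
    moreover have "(\<Sum>j<m. of_bool (0 < n \<and> Suc j * n \<le> m)) = card ({..<m} \<inter> {j. 0 < n \<and> Suc j * n \<le> m})"
      by (subst sum_of_bool_eq) simp_all
    ultimately show ?thesis
      using False by (simp add: Int_def)
  qed simp
  ultimately show "recursive 2 (\<lambda>ys. ys ! 0 div ys ! 1)" by simp
qed

lemma recursive_mod [rec_intros]: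
  assumes "recursive k f" "recursive k g"
  shows "recursive k (\<lambda>xs. f xs mod g xs)"
  unfolding modulo_nat_def by (intro rec_intros assms)

lemma recursive_prod_encode [rec_intros]:
  assumes "recursive k f" "recursive k g"
  shows "recursive k (\<lambda>xs. prod_encode (f xs, g xs))"
  unfolding prod_encode_def triangle_def by (simp, intro rec_intros assms)

lemma recursive_prod_decode:
  assumes "recursive k f"
  shows recursive_fst_prod_decode [rec_intros]: "recursive k (\<lambda>xs. fst (prod_decode (f xs)))" (is ?fst)
    and recursive_snd_prod_decode [rec_intros]: "recursive k (\<lambda>xs. snd (prod_decode (f xs)))" (is ?snd)
proof -
  \<comment> \<open>A code bounds both of its components, so the condition holds for exactly one
    term of the double sum.\<close>
  have split: "(\<Sum>p<Suc w. \<Sum>q<Suc w. h p q * of_bool (prod_encode (p, q) = w)) =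
      h (fst (prod_decode w)) (snd (prod_decode w))" (is "?S = _") for w :: nat and h :: "nat \<Rightarrow> nat \<Rightarrow> nat"
  proof -
    obtain p q where pq: "w = prod_encode (p, q)"
      by (metis prod_decode_inverse surj_pair)
    have "?S = (\<Sum>p'<Suc w. \<Sum>q'<Suc w. if p' = p \<and> q' = q then h p q else 0)"
      by (intro sum.cong) (auto simp: pq)
    also have "\<dots> = (\<Sum>p'<Suc w. if p' = p then h p q else 0)"
      using le_prod_encode_2[of q p] by (intro sum.cong) (auto simp: pq)
    also have "\<dots> = h p q"
      using le_prod_encode_1[of p q] by (auto simp: pq)
    finally show ?thesis by (simp add: pq)
  qed
  have "recursive k (\<lambda>xs. \<Sum>p<Suc (f xs). \<Sum>q<Suc (f xs). p * of_bool (prod_encode (p, q) = f xs))"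
    by (rule recursive_apply1[OF _ assms], intro rec_intros) auto
  then show ?fst by (simp only: split)
  have "recursive k (\<lambda>xs. \<Sum>p<Suc (f xs). \<Sum>q<Suc (f xs). q * of_bool (prod_encode (p, q) = f xs))"
    by (rule recursive_apply1[OF _ assms], intro rec_intros) auto
  then show ?snd by (simp only: split)
qed

text \<open>\<open>Mu\<close> looks for a zero, so it is applied to the characteristic function of
  the negation, which is total. Halting is claimed only where a witness exists, since decoders have
  to search for certificates that only valid programs possess.\<close>

lemma eval_search:
  assumes "decidable (Suc k) (\<lambda>ys. P (ys ! 0) (tl ys))"
  obtains r where "\<And>os xs. length xs = k \<Longrightarrow> \<exists>n. P n xs \<Longrightarrow> eval os r xs (LEAST n. P n xs)"
proof -
  have "recursive (Suc k) (\<lambda>ys. of_bool (\<not> P (ys ! 0) (tl ys)))"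
    by (intro rec_intros assms)
  then obtain r where r: "\<And>os ys. length ys = Suc k \<Longrightarrow> eval os r ys (of_bool (\<not> P (ys ! 0) (tl ys)))"
    unfolding recursive_def by blast
  have "eval os (Mu r) xs (LEAST n. P n xs)" if "length xs = k" "\<exists>n. P n xs" for os xs
  proof (rule eval.eval_mu)
    show "eval os r ((LEAST n. P n xs) # xs) 0"
      using r[of "(LEAST n. P n xs) # xs" os] that LeastI_ex[OF that(2)] by simp
    show "\<forall>j<LEAST n. P n xs. \<exists>v. eval os r (j # xs) (Suc v)"
    proof (intro allI impI exI[of _ 0])
      fix j
      assume "j < (LEAST n. P n xs)"
      then have "\<not> P j xs" by (rule not_less_Least)
      then show "eval os r (j # xs) (Suc 0)"
        using r[of "j # xs" os] that by simp
    qed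
  qed
  then show ?thesis using that by blast
qed

lemma recursive_Least:
  assumes "decidable (Suc k) (\<lambda>ys. P (ys ! 0) (tl ys))" "\<And>xs. \<exists>n. P n xs"
  shows "recursive k (\<lambda>xs. LEAST n. P n xs)"
  by (rule eval_search[OF assms(1)]) (use assms(2) in \<open>auto simp: recursive_def\<close>)

section \<open>Kleene normal form\<close>

text \<open>The staged simulations take their arguments as one list; here that list is assembled
  entry by entry from recursive functions.\<close>

lemma recursive_apply_Cons:
  assumes "recursive (Suc (length hs)) (\<lambda>ys. g (ys ! 0) (tl ys))"
    "recursive k a" "\<And>h. h \<in> set hs \<Longrightarrow> recursive k h"
  shows "recursive k (\<lambda>xs. g (a xs) (map (\<lambda>h. h xs) hs))"
  using recursive_comp[of "a # hs" "\<lambda>ys. g (ys ! 0) (tl ys)" k] assms by auto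

lemma decidable_Ball_set:
  "(\<And>g. g \<in> set gs \<Longrightarrow> decidable k (P g)) \<Longrightarrow> decidable k (\<lambda>xs. \<forall>g\<in>set gs. P g xs)"
proof (induction gs)
  case Nil
  show ?case unfolding decidable_def by (simp add: recursive_const)
next
  case (Cons g gs)
  then show ?case
    using decidable_conj[of k "P g" "\<lambda>xs. \<forall>g\<in>set gs. P g xs"] by simp
qed

text \<open>Kleene normal form for a single term: \<open>g s xs\<close> is the result of running \<open>r\<close> for
  \<open>s\<close> steps, with \<open>0\<close> for no answer and \<open>Suc v\<close> for the answer \<open>v\<close>.\<close>

definition approximates :: "nat \<Rightarrow> recf \<Rightarrow> (nat \<Rightarrow> nat list \<Rightarrow> nat) \<Rightarrow> bool" where
  "approximates k r g \<longleftrightarrow> recursive (Suc k) (\<lambda>ys. g (ys ! 0) (tl ys)) \<and>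
     (\<forall>xs. length xs = k \<longrightarrow>
        (\<forall>v. eval [] r xs v \<longleftrightarrow> (\<exists>s. g s xs = Suc v)) \<and>
        (\<forall>s s' v. s \<le> s' \<longrightarrow> g s xs = Suc v \<longrightarrow> g s' xs = Suc v))"

lemma approximates_never:
  assumes "\<And>xs v. length xs = k \<Longrightarrow> \<not> eval [] r xs v"
  shows "approximates k r (\<lambda>_ _. 0)"
  using assms by (auto simp: approximates_def intro: rec_intros)

lemma approximates_total:
  assumes "recursive (Suc k) (\<lambda>ys. f (tl ys))" "\<And>xs. length xs = k \<Longrightarrow> eval [] r xs (f xs)"
  shows "approximates k r (\<lambda>_ xs. Suc (f xs))"
  using assms by (auto simp: approximates_def intro: rec_intros dest: eval_deterministic)

text \<open>All parts are run for the same number of steps. Answers persist, so the stages at which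
  the parts answer can be replaced by a common later one.\<close>

lemma approximates_Comp:
  assumes F: "approximates (length gs) f F" and G: "\<And>g. g \<in> set gs \<Longrightarrow> approximates k g (G g)"
  shows "approximates k (Comp f gs)
    (\<lambda>s xs. if \<forall>g\<in>set gs. G g s xs \<noteq> 0 then F s (map (\<lambda>g. G g s xs - 1) gs) else 0)"
    (is "approximates k _ ?H")
  unfolding approximates_def
proof (intro conjI allI impI)
  have G': "recursive (Suc k) (\<lambda>ys. G g (ys ! 0) (tl ys))" if "g \<in> set gs" for g
    using G[OF that] by (simp add: approximates_def)
  have "recursive (Suc k) (\<lambda>ys. F (ys ! 0) (map (\<lambda>h. h ys) (map (\<lambda>g ys. G g (ys ! 0) (tl ys) - 1) gs)))"
    by (rule recursive_apply_Cons[where g = F])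
       (use F G' in \<open>auto simp: approximates_def intro!: rec_intros\<close>)
  then have F': "recursive (Suc k) (\<lambda>ys. F (ys ! 0) (map (\<lambda>g. G g (ys ! 0) (tl ys) - 1) gs))"
    by (simp add: comp_def)
  have "decidable (Suc k) (\<lambda>ys. \<forall>g\<in>set gs. G g (ys ! 0) (tl ys) \<noteq> 0)"
  proof (rule decidable_Ball_set)
    show "decidable (Suc k) (\<lambda>ys. G g (ys ! 0) (tl ys) \<noteq> 0)" if "g \<in> set gs" for g
      by (rule decidable_not, rule decidable_eq[OF G'[OF that] recursive_const])
  qed
  then show "recursive (Suc k) (\<lambda>ys. ?H (ys ! 0) (tl ys))"
    by (rule recursive_if) (rule F', rule recursive_const)
next
  fix xs :: "nat list"
  assume len: "length xs = k"
  have Gev: "eval [] g xs v \<longleftrightarrow> (\<exists>s. G g s xs = Suc v)" if "g \<in> set gs" for g v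
    using G[OF that] len by (simp add: approximates_def)
  have Gmono: "G g s xs = Suc v \<Longrightarrow> s \<le> s' \<Longrightarrow> G g s' xs = Suc v" if "g \<in> set gs" for g v s s'
    using G[OF that] len unfolding approximates_def by blast
  have Fev: "eval [] f ys v \<longleftrightarrow> (\<exists>s. F s ys = Suc v)" if "length ys = length gs" for ys v
    using F that by (simp add: approximates_def)
  have Fmono: "F s ys = Suc v \<Longrightarrow> s \<le> s' \<Longrightarrow> F s' ys = Suc v" if "length ys = length gs" for ys v s s'
    using F that unfolding approximates_def by blast
  show "eval [] (Comp f gs) xs v \<longleftrightarrow> (\<exists>s. ?H s xs = Suc v)" for v
  proof
    assume "eval [] (Comp f gs) xs v"
    then obtain ys where ys: "length ys = length gs" "\<forall>i<length gs. eval [] (gs ! i) xs (ys ! i)"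
      "eval [] f ys v" by (cases rule: eval.cases) auto
    then have "\<forall>i<length gs. \<exists>s. G (gs ! i) s xs = Suc (ys ! i)"
      by (simp add: Gev)
    then obtain S where S: "\<And>i. i < length gs \<Longrightarrow> G (gs ! i) (S i) xs = Suc (ys ! i)"
      by metis
    obtain s where s: "F s ys = Suc v"
      using ys Fev by blast
    \<comment> \<open>The sum is at least the stage of every single part.\<close>
    define m where "m = s + (\<Sum>i<length gs. S i)"
    have m: "G (gs ! i) m xs = Suc (ys ! i)" if "i < length gs" for i
      using member_le_sum[of i "{..<length gs}" S] that
      by (intro Gmono[OF _ S[OF that]]) (auto simp: m_def)
    then have "map (\<lambda>g. G g m xs - 1) gs = ys"
      using ys(1) by (intro nth_equalityI) auto
    moreover have "\<forall>g\<in>set gs. G g m xs \<noteq> 0"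
      using m by (auto simp: in_set_conv_nth)
    moreover have "F m ys = Suc v"
      by (rule Fmono[OF ys(1) s]) (simp add: m_def)
    ultimately show "\<exists>s. ?H s xs = Suc v" by (intro exI[of _ m]) simp
  next
    assume "\<exists>s. ?H s xs = Suc v"
    then obtain s where s: "\<forall>g\<in>set gs. G g s xs \<noteq> 0" "F s (map (\<lambda>g. G g s xs - 1) gs) = Suc v"
      by (auto split: if_splits)
    show "eval [] (Comp f gs) xs v"
    proof (rule eval.eval_comp)
      show "eval [] f (map (\<lambda>g. G g s xs - 1) gs) v"
        using s by (auto simp: Fev)
      show "\<forall>i<length gs. eval [] (gs ! i) xs (map (\<lambda>g. G g s xs - 1) gs ! i)"
        using s(1) by (auto simp: Gev intro!: exI[of _ s])
    qed simp
  qed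
  show "?H s' xs = Suc v" if "s \<le> s'" "?H s xs = Suc v" for s s' v
  proof -
    have s: "\<forall>g\<in>set gs. G g s xs \<noteq> 0" "F s (map (\<lambda>g. G g s xs - 1) gs) = Suc v"
      using that(2) by (auto split: if_splits)
    have "\<forall>g\<in>set gs. G g s' xs = G g s xs"
      using Gmono[OF _ _ that(1)] s(1) by (metis not0_implies_Suc)
    moreover from this have eq: "map (\<lambda>g. G g s' xs - 1) gs = map (\<lambda>g. G g s xs - 1) gs" by simp
    ultimately show ?thesis
      unfolding eq using s Fmono[OF _ s(2) that(1)] by simp
  qed
qed

text \<open>The accumulator holds \<open>Suc\<close> of the current value, unpacked by
  \<open>y - 1\<close>; once an answer is missing, the 0 is carried through to the end.\<close>

lemma approximates_Prim:
  assumes F: "approximates k f F" and G: "approximates (Suc (Suc k)) g G"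
  shows "approximates (Suc k) (Prim f g)
    (\<lambda>s xs. rec_nat (F s (tl xs)) (\<lambda>m y. if y = 0 then 0 else G s (m # (y - 1) # tl xs)) (hd xs))"
    (is "approximates _ _ ?H")
proof -
  let ?h = "\<lambda>s xs. rec_nat (F s xs) (\<lambda>m y. if y = 0 then 0 else G s (m # (y - 1) # xs))"
  have drop: "map (\<lambda>h. h ys) (map (\<lambda>i ys. ys ! (d + i)) [0..<k]) = drop d ys"
    if "length ys = d + k" for d and ys :: "nat list"
    using that by (intro nth_equalityI) auto
  have "recursive (Suc (Suc k)) (\<lambda>ys. ?h (ys ! 0) (tl (tl ys)) (ys ! 1))"
  proof (rule recursive_rec_nat)
    have "recursive (Suc (Suc k)) (\<lambda>ys. F (ys ! 0) (map (\<lambda>h. h ys) (map (\<lambda>i ys. ys ! (2 + i)) [0..<k])))"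
      by (rule recursive_apply_Cons[where g = F]) (use F in \<open>auto simp: approximates_def intro!: rec_intros\<close>)
    then show "recursive (Suc (Suc k)) (\<lambda>ys. F (ys ! 0) (tl (tl ys)))"
      by (rule recursive_cong) (simp only: drop, simp add: numeral_2_eq_2 drop_Suc)
    let ?k = "Suc (Suc (Suc (Suc k)))"
    have "recursive ?k (\<lambda>ys. G (ys ! 2) (map (\<lambda>h. h ys)
        ((\<lambda>ys. ys ! 0) # (\<lambda>ys. ys ! 1 - 1) # (map (\<lambda>i ys. ys ! (4 + i)) [0..<k]))))"
      by (rule recursive_apply_Cons[where g = G]) (use G in \<open>auto simp: approximates_def intro!: rec_intros\<close>)
    then have "recursive ?k (\<lambda>ys. G (tl (tl ys) ! 0) (ys ! 0 # (ys ! 1 - 1) # tl (tl (tl (tl ys)))))"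
      by (rule recursive_cong) (simp only: list.map drop, simp add: eval_nat_numeral drop_Suc nth_tl)
    then show "recursive ?k (\<lambda>ys. if ys ! 1 = 0 then 0 else
        G (tl (tl ys) ! 0) (ys ! 0 # (ys ! 1 - 1) # tl (tl (tl (tl ys)))))"
      by (rule recursive_if[rotated 2]) (rule decidable_eq rec_intros | simp)+
  qed (intro rec_intros, simp)
  then have "recursive (Suc (Suc k)) (\<lambda>ys. ?H (ys ! 0) (tl ys))"
    by (rule recursive_cong) (auto simp: length_Suc_conv)
  moreover have cons: "(\<forall>v. eval [] (Prim f g) (n # xs) v \<longleftrightarrow> (\<exists>s. ?h s xs n = Suc v)) \<and>
      (\<forall>s s' v. s \<le> s' \<longrightarrow> ?h s xs n = Suc v \<longrightarrow> ?h s' xs n = Suc v)" if len: "length xs = k" for n xs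
  proof (induction n)
    case 0
    have "eval [] (Prim f g) (0 # xs) v \<longleftrightarrow> eval [] f xs v" for v
      by (auto intro: eval.eval_prim0 elim: eval.cases)
    then show ?case
      using F len by (simp add: approximates_def)
  next
    case (Suc n)
    have Gev: "eval [] g ys v \<longleftrightarrow> (\<exists>s. G s ys = Suc v)" if "length ys = Suc (Suc k)" for ys v
      using G that by (simp add: approximates_def)
    have Gmono: "G s ys = Suc v \<Longrightarrow> s \<le> s' \<Longrightarrow> G s' ys = Suc v" if "length ys = Suc (Suc k)" for ys v s s'
      using G that unfolding approximates_def by blast
    have step: "?h s xs (Suc n) = Suc v \<longleftrightarrow> (\<exists>y. ?h s xs n = Suc y \<and> G s (n # y # xs) = Suc v)" for s v
      by (cases "?h s xs n") auto
    have ev: "eval [] (Prim f g) (Suc n # xs) v \<longleftrightarrow>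
        (\<exists>y. eval [] (Prim f g) (n # xs) y \<and> eval [] g (n # y # xs) v)" for v
      by (auto intro: eval.eval_primS elim: eval.cases)
    have ex: "(\<exists>y. eval [] (Prim f g) (n # xs) y \<and> eval [] g (n # y # xs) v) \<longleftrightarrow>
        (\<exists>s. ?h s xs (Suc n) = Suc v)" for v
      unfolding step
    proof (intro iffI; elim exE conjE)
      fix y
      assume "eval [] (Prim f g) (n # xs) y" "eval [] g (n # y # xs) v"
      then obtain s s' where s: "?h s xs n = Suc y" "G s' (n # y # xs) = Suc v"
        using Suc Gev[of "n # y # xs"] len by auto
      have "?h (max s s') xs n = Suc y"
        using Suc s(1) by (meson max.cobounded1)
      moreover have "G (max s s') (n # y # xs) = Suc v"
        using Gmono[OF _ s(2)] len by simp
      ultimately show "\<exists>s y. ?h s xs n = Suc y \<and> G s (n # y # xs) = Suc v"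
        by blast
    next
      fix s y
      assume "?h s xs n = Suc y" "G s (n # y # xs) = Suc v"
      then show "\<exists>y. eval [] (Prim f g) (n # xs) y \<and> eval [] g (n # y # xs) v"
        using Suc Gev[of "n # y # xs" v] len by auto
    qed
    have "?h s' xs (Suc n) = Suc v" if "s \<le> s'" "?h s xs (Suc n) = Suc v" for s s' v
      using that(2) Suc that(1) Gmono[of "n # _ # xs" s v s'] len unfolding step by auto
    then show ?case
      using ev ex by blast
  qed
  moreover have "(\<forall>v. eval [] (Prim f g) xs v \<longleftrightarrow> (\<exists>s. ?H s xs = Suc v)) \<and>
      (\<forall>s s' v. s \<le> s' \<longrightarrow> ?H s xs = Suc v \<longrightarrow> ?H s' xs = Suc v)" if "length xs = Suc k" for xs
  proof -
    from that obtain n zs where xs: "xs = n # zs" and "length zs = k"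
      by (cases xs) auto
    from cons[OF this(2), of n] show ?thesis
      unfolding xs list.sel .
  qed
  ultimately show ?thesis unfolding approximates_def by blast
qed

text \<open>An answer 0 shows up as 1 and a positive answer as a number from 2 on. At most one
  \<open>n\<close> answers 0 after positive answers only, so the sum has at most one nonzero term,
  which is \<open>Suc n\<close>.\<close>

lemma approximates_Mu:
  assumes F: "approximates (Suc k) f F"
  shows "approximates k (Mu f)
    (\<lambda>s xs. \<Sum>n<s. Suc n * of_bool (F s (n # xs) = 1 \<and> (\<forall>m<n. 2 \<le> F s (m # xs))))"
    (is "approximates _ _ ?H")
  unfolding approximates_def
proof (intro conjI allI impI)
  have F': "recursive (Suc (Suc (d + k))) (\<lambda>ys. F (ys ! Suc d) (ys ! 0 # drop (d + 2) ys))" for d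
  proof (rule recursive_cong)
    show "recursive (Suc (Suc (d + k))) (\<lambda>ys. F (ys ! Suc d) (map (\<lambda>h. h ys)
        ((\<lambda>ys. ys ! 0) # map (\<lambda>i ys. ys ! (d + 2 + i)) [0..<k])))"
      by (rule recursive_apply_Cons[where g = F]) (use F in \<open>auto simp: approximates_def intro!: rec_intros\<close>)
    show "F (ys ! Suc d) (map (\<lambda>h. h ys) ((\<lambda>ys. ys ! 0) # map (\<lambda>i ys. ys ! (d + 2 + i)) [0..<k])) =
        F (ys ! Suc d) (ys ! 0 # drop (d + 2) ys)" if "length ys = Suc (Suc (d + k))" for ys
    proof -
      have "map (\<lambda>h. h ys) (map (\<lambda>i ys. ys ! (d + 2 + i)) [0..<k]) = drop (d + 2) ys"
        using that by (intro nth_equalityI) auto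
      then show ?thesis by (simp only: list.map)
    qed
  qed
  have 1: "recursive (Suc (Suc k)) (\<lambda>ys. F (tl ys ! 0) (ys ! 0 # tl (tl ys)))"
    using F'[of 0, simplified] by (rule recursive_cong) (auto simp: numeral_2_eq_2 drop_Suc nth_tl)
  have 2: "recursive (Suc (Suc (Suc k))) (\<lambda>ys. F (tl (tl ys) ! 0) (ys ! 0 # tl (tl (tl ys))))"
    using F'[of 1, simplified] by (rule recursive_cong) (auto simp: eval_nat_numeral drop_Suc nth_tl)
  show "recursive (Suc k) (\<lambda>ys. ?H (ys ! 0) (tl ys))"
    by (intro rec_intros 1 2) auto
next
  fix xs :: "nat list"
  assume len: "length xs = k"
  have Fev: "eval [] f (n # xs) v \<longleftrightarrow> (\<exists>s. F s (n # xs) = Suc v)" for n v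
    using F len by (simp add: approximates_def)
  have Fmono: "F s (n # xs) = Suc v \<Longrightarrow> s \<le> s' \<Longrightarrow> F s' (n # xs) = Suc v" for n v s s'
    using F len unfolding approximates_def by (metis length_Cons)
  let ?P = "\<lambda>s n. F s (n # xs) = 1 \<and> (\<forall>m<n. 2 \<le> F s (m # xs))"
  have H: "?H s xs = Suc v \<longleftrightarrow> v < s \<and> ?P s v" for s v
  proof (cases "\<exists>n<s. ?P s n")
    case True
    then obtain n where n: "n < s" "?P s n" by blast
    have uniq: "?P s m \<longleftrightarrow> m = n" for m
      using n(2) by (metis Suc_1 Suc_n_not_le_n nat_neq_iff)
    have "?H s xs = (\<Sum>m<s. if m = n then Suc m else 0)"
      by (intro sum.cong refl) (simp only: uniq, simp)
    then show ?thesis using n(1) by (simp only: uniq) auto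
  next
    case False
    then have 0: "?H s xs = 0" by (intro sum.neutral) auto
    show ?thesis unfolding 0 using False by auto
  qed
  show "eval [] (Mu f) xs v \<longleftrightarrow> (\<exists>s. ?H s xs = Suc v)" for v
    unfolding H
  proof
    assume "eval [] (Mu f) xs v"
    then obtain w where "eval [] f (v # xs) 0" "\<And>m. m < v \<Longrightarrow> eval [] f (m # xs) (Suc (w m))"
      by (cases rule: eval.cases) metis
    then obtain s S where s: "F s (v # xs) = Suc 0" and
      S: "\<And>m. m < v \<Longrightarrow> F (S m) (m # xs) = Suc (Suc (w m))"
      unfolding Fev by metis
    define t where "t = Suc v + s + (\<Sum>m<v. S m)"
    have "F t (v # xs) = Suc 0"
      by (rule Fmono[OF s]) (simp add: t_def)
    moreover have "F t (m # xs) = Suc (Suc (w m))" if "m < v" for m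
      using member_le_sum[of m "{..<v}" S] that
      by (intro Fmono[OF S[OF that]]) (auto simp: t_def)
    ultimately show "\<exists>s. v < s \<and> ?P s v"
      by (intro exI[of _ t]) (simp add: t_def)
  next
    assume "\<exists>s. v < s \<and> ?P s v"
    then obtain s where s: "F s (v # xs) = Suc 0" "\<And>m. m < v \<Longrightarrow> 2 \<le> F s (m # xs)" by auto
    show "eval [] (Mu f) xs v"
    proof (rule eval.eval_mu)
      show "\<forall>m<v. \<exists>w. eval [] f (m # xs) (Suc w)"
        using s(2) unfolding Fev by (metis One_nat_def Suc_1 Suc_le_D Suc_le_eq less_Suc_eq_le)
    qed (use s Fev in blast)
  qed
  show "?H s' xs = Suc v" if "s \<le> s'" "?H s xs = Suc v" for s s' v
  proof -
    have s: "v < s" "F s (v # xs) = Suc 0" "\<And>m. m < v \<Longrightarrow> 2 \<le> F s (m # xs)"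
      using that(2) unfolding H by auto
    have "F s' (m # xs) = F s (m # xs)" if "m < v" for m
      using Fmono[OF _ \<open>s \<le> s'\<close>] s(3)[OF that] by (metis not0_implies_Suc not_numeral_le_zero)
    then show ?thesis
      unfolding H using s Fmono[OF s(2) that(1)] that(1) by auto
  qed
qed

text \<open>By induction on the term, each term gets its own simulation. With the empty oracle list
  an \<open>Oracle\<close> term never answers, nor do \<open>Succ\<close>, \<open>Proj\<close> and
  \<open>Prim\<close> on too few arguments; these get the constant 0.\<close>

theorem approximates_exists: "\<exists>g. approximates k r g"
proof (induction r arbitrary: k)
  case Zero
  have "approximates k Zero (\<lambda>_ xs. Suc 0)"
    by (rule approximates_total) (auto intro: rec_intros eval.eval_zero)
  then show ?case by blast
next
  case Succ
  show ?case
  proof (cases k)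
    case 0
    then have "approximates k Succ (\<lambda>_ _. 0)"
      by (intro approximates_never) (auto elim: eval.cases)
    then show ?thesis by blast
  next
    case (Suc k')
    then have "approximates k Succ (\<lambda>_ xs. Suc (Suc (xs ! 0)))"
      by (intro approximates_total) (auto intro!: rec_intros intro: eval.eval_succ simp: length_Suc_conv)
    then show ?thesis by blast
  qed
next
  case (Proj i)
  show ?case
  proof (cases "i < k")
    case False
    then have "approximates k (Proj i) (\<lambda>_ _. 0)"
      by (intro approximates_never) (auto elim: eval.cases)
    then show ?thesis by blast
  next
    case True
    then have "approximates k (Proj i) (\<lambda>_ xs. Suc (xs ! i))"
      by (intro approximates_total) (auto intro!: rec_intros intro: eval.eval_proj)
    then show ?thesis by blast
  qed
next
  case (Comp f gs)
  obtain F where "approximates (length gs) f F"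
    using Comp.IH(1) by blast
  moreover have "\<forall>g\<in>set gs. \<exists>G. approximates k g G"
    using Comp.IH(2) by blast
  then obtain G where "\<And>g. g \<in> set gs \<Longrightarrow> approximates k g (G g)"
    by metis
  ultimately show ?case by (blast intro: approximates_Comp)
next
  case (Prim f g)
  show ?case
  proof (cases k)
    case 0
    then have "approximates k (Prim f g) (\<lambda>_ _. 0)"
      by (intro approximates_never) (auto elim: eval.cases)
    then show ?thesis by blast
  next
    case (Suc k')
    then show ?thesis using approximates_Prim Prim by blast
  qed
next
  case (Mu f)
  then show ?case using approximates_Mu by blast
next
  case (Oracle i)
  have "approximates k (Oracle i) (\<lambda>_ _. 0)"
    by (intro approximates_never) (auto elim: eval.cases)
  then show ?case by blast
qed

section \<open>Descriptions of elements of enumerable sets\<close>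

abbreviation str_val :: "bool list \<Rightarrow> nat" where
  "str_val \<equiv> horner_sum of_bool 2"

text \<open>\<open>bstr_code\<close> is bijective binary notation with digits 1 and 2, least
  significant first; adding one turns it into ordinary binary notation with a leading 1 that marks
  the length.\<close>

lemma Suc_bstr_code: "Suc (bstr_code w) = 2 ^ length w + str_val w"
  by (induction w) auto

lemma str_val_less: "str_val w < 2 ^ length w"
  by (induction w) auto

lemma bstr_code_eq_iff [simp]: "bstr_code v = bstr_code w \<longleftrightarrow> v = w"
proof (induction v arbitrary: w)
  case Nil
  show ?case by (cases w) auto
next
  case (Cons b v)
  show ?case
  proof (cases w)
    case (Cons c w')
    have "2 * bstr_code v + (if b then 2 else 1) = 2 * bstr_code w' + (if c then 2 else 1) \<longleftrightarrow>
        b = c \<and> bstr_code v = bstr_code w'"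
      by (cases b; cases c) presburger+
    then show ?thesis using Cons Cons.IH by simp
  qed simp
qed

lemma bstr_code_surj: obtains w where "bstr_code w = m"
proof -
  have "\<exists>w. bstr_code w = m"
  proof (induction m rule: less_induct)
    case (less m)
    show ?case
    proof (cases "m = 0")
      case False
      then obtain w where "bstr_code w = (m - 1) div 2"
        using less[of "(m - 1) div 2"] by (metis One_nat_def div_le_dividend diff_Suc_less le_less_trans neq0_conv)
      with False have "bstr_code (even m # w) = m" by (auto simp: odd_pos)
      then show ?thesis by blast
    qed (auto intro: exI[of _ "[]"])
  qed
  then show ?thesis using that by blast
qed

text \<open>The shift by one makes the logarithm nonnegative also at 0 and fits
  \<open>Suc_bstr_code\<close>: \<open>lg (bstr_code w)\<close> is the length of \<open>w\<close> up
  to less than one bit.\<close>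

definition lg :: "nat \<Rightarrow> real" where
  "lg n = log 2 (real n + 1)"

lemma lg_nonneg [simp]: "0 \<le> lg n"
  by (simp add: lg_def)

lemma lg_mono: "m \<le> n \<Longrightarrow> lg m \<le> lg n"
  by (simp add: lg_def)

text \<open>The pairing polynomial is quadratic. The factor 2 is affordable because only parameters
  of logarithmic cost are paired in this way.\<close>

lemma lg_prod_encode: "lg (prod_encode (a, b)) \<le> 2 * lg a + 2 * lg b"
proof -
  have "2 * triangle (a + b) = (a + b) * Suc (a + b)"
    unfolding triangle_def by (rule dvd_mult_div_cancel) simp
  then have "Suc (prod_encode (a, b)) \<le> (Suc a * Suc b) ^ 2"
    by (simp add: prod_encode_def power2_eq_square algebra_simps)
  then have "real (prod_encode (a, b)) + 1 \<le> ((real a + 1) * (real b + 1)) ^ 2"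
    by (metis (no_types, lifting) of_nat_Suc of_nat_le_iff of_nat_mult of_nat_power add.commute)
  then have "lg (prod_encode (a, b)) \<le> log 2 (((real a + 1) * (real b + 1)) ^ 2)"
    by (simp add: lg_def)
  also have "\<dots> = 2 * lg a + 2 * lg b"
    by (simp add: lg_def log_nat_power log_mult)
  finally show ?thesis .
qed

lemma lg_bstr_code: "real (length w) \<le> lg (bstr_code w)" "lg (bstr_code w) < real (length w) + 1"
proof -
  have 1: "real (bstr_code w) + 1 = real (2 ^ length w + str_val w)"
    using Suc_bstr_code[of w] by (metis of_nat_Suc add.commute)
  have "log 2 (2 ^ length w) \<le> lg (bstr_code w)"
    unfolding lg_def 1 by (subst log_le_cancel_iff) (auto simp: add_pos_nonneg)
  then show "real (length w) \<le> lg (bstr_code w)" by simp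
  have "2 ^ length w + str_val w < 2 ^ Suc (length w)"
    using str_val_less[of w] by simp
  then have "real (2 ^ length w + str_val w) < 2 ^ Suc (length w)"
    by (metis of_nat_less_iff of_nat_numeral of_nat_power)
  then have "lg (bstr_code w) < log 2 (2 ^ Suc (length w))"
    unfolding lg_def 1 by (subst log_less_cancel_iff) (auto simp: add_pos_nonneg)
  then show "lg (bstr_code w) < real (length w) + 1"
    by (subst (asm) log_nat_power) auto
qed

text \<open>With \<open>2 ^ l \<approx> s\<close> this pairing adds only \<open>2 log s + O(1)\<close> bits to \<open>q\<close>.\<close>

lemma pairing_injective:
  fixes s t q p l k :: nat
  assumes "2 ^ l * (2 * (2 ^ l * q + s) + 1) = 2 ^ k * (2 * (2 ^ k * p + t) + 1)" "s < 2 ^ l" "t < 2 ^ k"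
  shows "l = k \<and> s = t \<and> q = p"
proof -
  \<comment> \<open>The exponents are compared through the power of 2 in the number, the cofactor
    being odd.\<close>
  have aux: "\<not> l < k" if "2 ^ l * (2 * x + 1) = 2 ^ k * (2 * y + 1)" for l k x y :: nat
  proof
    assume "l < k"
    then obtain d where "k = Suc (l + d)"
      using less_imp_Suc_add by blast
    then have "2 ^ l * (2 * x + 1) = 2 ^ l * (2 * (2 ^ d * (2 * y + 1)))"
      unfolding that by (simp add: power_add algebra_simps)
    then have "2 * x + 1 = 2 * (2 ^ d * (2 * y + 1))"
      unfolding mult_left_cancel[OF power_not_zero[of "2::nat" l, OF zero_neq_numeral[symmetric]]] .
    from arg_cong[OF this, of even] show False by simp
  qed
  have lk: "l = k"
    using aux[OF assms(1)] aux[OF assms(1)[symmetric]] by simp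
  then have eq: "2 ^ k * q + s = 2 ^ k * p + t" using assms(1) by simp
  have "s = t"
    using arg_cong[OF eq, of "\<lambda>x. x mod 2 ^ k"] assms(2,3) lk by simp
  with eq lk show ?thesis by simp
qed

text \<open>In an enumeration \<open>h\<close>, stage \<open>e\<close> yields nothing if \<open>h e = 0\<close> and the element \<open>w\<close> if \<open>h e = Suc w\<close>.
  An element is described by the rank of the stage at which it first appears.\<close>

definition fresh :: "(nat \<Rightarrow> nat) \<Rightarrow> nat \<Rightarrow> bool" where
  "fresh h e \<longleftrightarrow> h e \<noteq> 0 \<and> (\<forall>e'<e. h e' \<noteq> h e)"

definition rank :: "(nat \<Rightarrow> nat) \<Rightarrow> nat \<Rightarrow> nat" where
  "rank h e = (\<Sum>e'<e. of_bool (fresh h e'))"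

lemma rank_eq_card: "rank h e = card {e'. e' < e \<and> fresh h e'}"
  unfolding rank_def by (subst sum_of_bool_eq) (auto simp: Int_def lessThan_def)

lemma rank_strict_mono:
  assumes "fresh h e" "e < e'"
  shows "rank h e < rank h e'"
  unfolding rank_eq_card using assms by (intro psubset_card_mono) auto

lemma rank_injective: "fresh h e \<Longrightarrow> fresh h e' \<Longrightarrow> rank h e = rank h e' \<Longrightarrow> e = e'"
  using rank_strict_mono by (metis less_irrefl nat_neq_iff)

lemma rank_less_card:
  assumes "fresh h e" "finite {w. \<exists>e. h e = Suc w}"
  shows "rank h e < card {w. \<exists>e. h e = Suc w}"
proof -
  let ?F = "{e'. e' < Suc e \<and> fresh h e'}"
  have "rank h e < card ?F"
    using rank_strict_mono[OF assms(1) lessI] by (simp add: rank_eq_card)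
  also have "card ?F \<le> card {w. \<exists>e. h e = Suc w}"
  proof (rule card_inj_on_le)
    show "inj_on (\<lambda>e. h e - 1) ?F"
      by (rule inj_onI) (metis (mono_tags, lifting) One_nat_def Suc_pred fresh_def linorder_neqE_nat mem_Collect_eq neq0_conv)
    show "(\<lambda>e. h e - 1) ` ?F \<subseteq> {w. \<exists>e. h e = Suc w}"
      by (auto simp: fresh_def)
  qed fact
  finally show ?thesis .
qed

lemma fresh_exists:
  assumes "h e = Suc w"
  shows "\<exists>e. fresh h e \<and> h e = Suc w"
proof -
  define d where "d = (LEAST e. h e = Suc w)"
  have "h d = Suc w"
    unfolding d_def using assms by (rule LeastI)
  moreover have "h e' \<noteq> Suc w" if "e' < d" for e'
    using that not_less_Least unfolding d_def by blast
  ultimately show ?thesis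
    unfolding fresh_def by (intro exI[of _ d]) auto
qed

text \<open>An element is recovered from its rank, which takes \<open>j\<close> bits. The datum
  \<open>b\<close> occupies the bits above the rank and so enters with factor 1, which matters when
  it is a long program; only \<open>a\<close> and \<open>j\<close> go through the costlier
  pairing.\<close>

lemma index_decoder:
  assumes "recursive 3 (\<lambda>xs. h (xs ! 0) (xs ! 1) (xs ! 2))"
  obtains r where "\<And>a b j u. finite {w. \<exists>e. h a b e = Suc w} \<Longrightarrow> card {w. \<exists>e. h a b e = Suc w} \<le> 2 ^ j \<Longrightarrow>
      (\<exists>e. h a b e = Suc u) \<Longrightarrow>
      \<exists>m. eval [] r [m] u \<and> lg m \<le> real j + lg b + 4 * (lg a + lg j) + 3"
proof -
  note h = recursive_apply3[of h, OF assms]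
  \<comment> \<open>\<open>w\<close> lists the exponent \<open>l\<close>, the pair \<open>s\<close>
    of \<open>a\<close> and \<open>j\<close>, the number \<open>q\<close> made of \<open>b\<close>
    and the rank, and the stage \<open>e\<close> that has this rank.\<close>
  define P where "P w m = (let l = fst (prod_decode w); s = fst (prod_decode (snd (prod_decode w)));
      q = fst (prod_decode (snd (prod_decode (snd (prod_decode w)))));
      e = snd (prod_decode (snd (prod_decode (snd (prod_decode w)))));
      a = fst (prod_decode s); b = q div 2 ^ snd (prod_decode s) in
      s < 2 ^ l \<and> m = 2 ^ l * (2 * (2 ^ l * q + s) + 1) \<and> fresh (h a b) e \<and>
      rank (h a b) e = q mod 2 ^ snd (prod_decode s))" for w m :: nat
  define out where "out w = (let s = fst (prod_decode (snd (prod_decode w)));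
      q = fst (prod_decode (snd (prod_decode (snd (prod_decode w)))));
      e = snd (prod_decode (snd (prod_decode (snd (prod_decode w))))) in
      h (fst (prod_decode s)) (q div 2 ^ snd (prod_decode s)) e - 1)" for w :: nat
  have "decidable (Suc 1) (\<lambda>ys. P (ys ! 0) (tl ys ! 0))"
    unfolding P_def Let_def fresh_def rank_def by (intro rec_intros h) simp_all
  from eval_search[of 1 "\<lambda>w xs. P w (xs ! 0)", OF this] obtain r1 where
    "\<And>os xs. length xs = 1 \<Longrightarrow> \<exists>n. P n (xs ! 0) \<Longrightarrow> eval os r1 xs (LEAST n. P n (xs ! 0))"
    by blast
  from this[of "[_]"] have r1: "\<exists>n. P n m \<Longrightarrow> eval [] r1 [m] (LEAST n. P n m)" for m
    by simp
  have "recursive 1 (\<lambda>xs. out (xs ! 0))"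
    unfolding out_def Let_def by (intro rec_intros h) simp_all
  then obtain r2 where "\<And>os xs. length xs = 1 \<Longrightarrow> eval os r2 xs (out (xs ! 0))"
    unfolding recursive_def by blast
  from this[of "[_]"] have r2: "eval [] r2 [w] (out w)" for w
    by simp
  \<comment> \<open>The search returns the least certificate; uniqueness makes it the intended
    one.\<close>
  have uniq: "w = w'" if "P w m" "P w' m" for w w' m
  proof -
    obtain l s q e where w: "w = prod_encode (l, prod_encode (s, prod_encode (q, e)))"
      by (metis prod_decode_inverse surj_pair)
    obtain l' s' q' e' where w': "w' = prod_encode (l', prod_encode (s', prod_encode (q', e')))"
      by (metis prod_decode_inverse surj_pair)
    from that have "l = l' \<and> s = s' \<and> q = q'"
      by (intro pairing_injective) (auto simp: P_def w w' Let_def)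
    with that show "w = w'"
      by (auto simp: P_def w w' Let_def intro: rank_injective)
  qed
  show ?thesis
  proof (rule that[of "Comp r2 [r1]"])
    fix a b j u
    assume fin: "finite {w. \<exists>e. h a b e = Suc w}" and card: "card {w. \<exists>e. h a b e = Suc w} \<le> 2 ^ j"
      and ex: "\<exists>e. h a b e = Suc u"
    obtain e where e: "fresh (h a b) e" "h a b e = Suc u"
      using ex fresh_exists[of "h a b"] by blast
    define i where "i = rank (h a b) e"
    have i: "i < 2 ^ j"
      using rank_less_card[OF e(1) fin] card by (simp add: i_def)
    define q where "q = b * 2 ^ j + i"
    define s where "s = prod_encode (a, j)"
    obtain l where l: "2 ^ l \<le> Suc s" "Suc s < 2 ^ Suc l"
      using ex_power_ivl1[of 2 "Suc s"] by auto
    define m :: nat where "m = 2 ^ Suc l * (2 * (2 ^ Suc l * q + s) + 1)"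
    define w where "w = prod_encode (Suc l, prod_encode (s, prod_encode (q, e)))"
    have P: "P w m"
      using l i e by (simp add: P_def w_def m_def s_def q_def i_def[symmetric] del: power_Suc)
    have "(LEAST n. P n m) = w"
      using uniq[OF P] P by (metis LeastI)
    moreover have "out w = u"
      using i e by (simp add: out_def w_def s_def q_def)
    ultimately have "eval [] (Comp r2 [r1]) [m] u"
      using r1[of m] r2[of w] P by (intro eval.eval_comp[where ys = "[w]"]) auto
    \<comment> \<open>The factor \<open>2 ^ Suc l\<close> occurs twice and is at most
      \<open>2 * Suc s\<close> each time, so \<open>s\<close> is paid for twice. With
      \<open>lg s\<close> at most \<open>2 * lg a + 2 * lg j\<close> this gives the factor 4; the 3
      is the logarithm of 8.\<close>
    moreover have "lg m \<le> real j + lg b + 4 * (lg a + lg j) + 3"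
    proof -
      have "2 * (2 ^ Suc l * q + s) + 1 < 2 * 2 ^ Suc l * Suc q"
        using l by simp
      then have "Suc m \<le> 2 ^ Suc l * (2 * 2 ^ Suc l * Suc q)"
        unfolding m_def Suc_le_eq by (intro mult_strict_left_mono) auto
      also have "\<dots> = 8 * ((2 ^ l * 2 ^ l) * Suc q)" by (simp add: algebra_simps)
      also have "\<dots> \<le> 8 * ((Suc s * Suc s) * (2 ^ j * Suc b))"
        using l i by (intro mult_left_mono mult_mono) (auto simp: q_def)
      finally have "real (Suc m) \<le> real (8 * ((Suc s * Suc s) * (2 ^ j * Suc b)))"
        by (rule of_nat_mono)
      then have "lg m \<le> log 2 (8 * (((real s + 1) * (real s + 1)) * (2 ^ j * (real b + 1))))"
        unfolding lg_def by (subst log_le_cancel_iff) (auto simp: algebra_simps)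
      also have "\<dots> = log 2 (2 ^ 3) + (lg s + lg s + (real j + lg b))"
        by (simp add: lg_def log_mult log_nat_power add_pos_pos)
      also have "\<dots> \<le> real j + lg b + 4 * (lg a + lg j) + 3"
        using lg_prod_encode[of a j] log_pow_cancel[of 2 3] by (simp add: s_def)
      finally show ?thesis .
    qed
    ultimately show "\<exists>m. eval [] (Comp r2 [r1]) [m] u \<and> lg m \<le> real j + lg b + 4 * (lg a + lg j) + 3"
      by blast
  qed
qed

section \<open>Balanced tables\<close>

text \<open>Digit expansions turn finite tables (base \<open>2 ^ R\<close>) and finite sets (base 2)
  into single numbers, over which a search can range.\<close>

lemma digits_exist:
  fixes D :: nat
  assumes "\<And>j. j < n \<Longrightarrow> f j < D"
  shows "\<exists>e<D ^ n. \<forall>j<n. e div D ^ j mod D = f j"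
  using assms
proof (induction n arbitrary: f)
  case (Suc n)
  obtain e where e: "e < D ^ n" "\<And>j. j < n \<Longrightarrow> e div D ^ j mod D = f (Suc j)"
    using Suc.IH[of "\<lambda>j. f (Suc j)"] Suc.prems by auto
  have f0: "f 0 < D" using Suc.prems by blast
  have "f 0 + D * e < D * Suc e"
    using f0 by simp
  also have "\<dots> \<le> D * D ^ n"
    using e(1) by (intro mult_left_mono) auto
  finally have "f 0 + D * e < D ^ Suc n" by simp
  moreover have "(f 0 + D * e) div D ^ j mod D = f j" if "j < Suc n" for j
    using e(2)[of "j - 1"] f0 that by (cases j) (auto simp: div_mult2_eq)
  ultimately show ?case by blast
qed simp

lemma bitmask_exists: "\<exists>B<2 ^ n. \<forall>u<n. B div 2 ^ u mod (2::nat) = 1 \<longleftrightarrow> u \<in> S"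
proof -
  have "\<exists>B<2 ^ n. \<forall>u<n. B div 2 ^ u mod (2::nat) = of_bool (u \<in> S)"
    by (rule digits_exist) auto
  then obtain B where "B < 2 ^ n" "\<And>u. u < n \<Longrightarrow> B div 2 ^ u mod (2::nat) = of_bool (u \<in> S)"
    by blast
  then show ?thesis by (intro exI[of _ B]) auto
qed

text \<open>An entry of a table of \<open>R\<close>-bit numbers, with rows and columns indexed by strings of
  length \<open>R\<^sup>2\<close>, that is packed into the single number \<open>e\<close>.\<close>

definition entry :: "nat \<Rightarrow> nat \<Rightarrow> nat \<Rightarrow> nat \<Rightarrow> nat" where
  "entry R e u v = e div (2 ^ R) ^ (u * 2 ^ (R ^ 2) + v) mod 2 ^ R"

text \<open>\<open>B\<close> and \<open>C\<close> are bit masks of sets of size at most \<open>K = 8 ^ R\<close>. The bound \<open>2 ^ (5 * R + 3)\<close> is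
  \<open>8 * (K * K) / 2 ^ R\<close>, eight times the average.\<close>

definition balanced :: "nat \<Rightarrow> nat \<Rightarrow> bool" where
  "balanced R e \<longleftrightarrow> (\<forall>B<(2::nat) ^ 2 ^ (R ^ 2). \<forall>C<(2::nat) ^ 2 ^ (R ^ 2). \<forall>a<2 ^ R.
     (\<Sum>u<2 ^ (R ^ 2). of_bool (B div 2 ^ u mod 2 = 1)) \<le> (8::nat) ^ R \<longrightarrow>
     (\<Sum>u<2 ^ (R ^ 2). of_bool (C div 2 ^ u mod 2 = 1)) \<le> (8::nat) ^ R \<longrightarrow>
     (\<Sum>u<2 ^ (R ^ 2). \<Sum>v<2 ^ (R ^ 2).
        of_bool (B div 2 ^ u mod 2 = 1 \<and> C div 2 ^ v mod 2 = 1 \<and> entry R e u v = a)) \<le> (2::nat) ^ (5 * R + 3))"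

lemma recursive_entry [rec_intros]:
  assumes "recursive k f" "recursive k g" "recursive k h" "recursive k l"
  shows "recursive k (\<lambda>xs. entry (f xs) (g xs) (h xs) (l xs))"
  unfolding entry_def by (intro rec_intros assms)

lemma entry_less: "entry R e u v < 2 ^ R"
  by (simp add: entry_def)

lemma entry_exists:
  assumes "\<And>u v. u < 2 ^ (R ^ 2) \<Longrightarrow> v < 2 ^ (R ^ 2) \<Longrightarrow> E u v < 2 ^ R"
  shows "\<exists>e. \<forall>u<2 ^ (R ^ 2). \<forall>v<2 ^ (R ^ 2). entry R e u v = E u v"
proof -
  let ?L = "2 ^ (R ^ 2) :: nat"
  have "\<exists>e<(2 ^ R) ^ (?L * ?L). \<forall>j<?L * ?L. e div (2 ^ R) ^ j mod 2 ^ R = E (j div ?L) (j mod ?L)"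
    by (rule digits_exist) (auto intro!: assms simp: less_mult_imp_div_less)
  then obtain e where e: "\<And>j. j < ?L * ?L \<Longrightarrow> e div (2 ^ R) ^ j mod 2 ^ R = E (j div ?L) (j mod ?L)"
    by blast
  have "entry R e u v = E u v" if "u < ?L" "v < ?L" for u v
  proof -
    have "u * ?L + v < Suc u * ?L" using that by simp
    also have "\<dots> \<le> ?L * ?L" using that by (intro mult_right_mono) auto
    finally show ?thesis using e[of "u * ?L + v"] that by (simp add: entry_def)
  qed
  then show ?thesis by blast
qed

text \<open>\<open>n ^ n / n!\<close> is one term of the exponential series at \<open>n\<close>, and
  e is at most 3.\<close>

lemma power_le_fact: "real n ^ n \<le> 3 ^ n * fact n"
proof -
  have "real n ^ n /\<^sub>R fact n \<le> (\<Sum>k. real n ^ k /\<^sub>R fact k)"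
    using sum_le_suminf[of "\<lambda>k. real n ^ k /\<^sub>R fact k" "{n}"] exp_converges[of "real n"]
    by (auto simp: sums_iff)
  also have "\<dots> = exp 1 ^ n"
    using exp_converges[of "real n"] by (simp add: sums_iff flip: exp_of_nat_mult)
  also have "\<dots> \<le> 3 ^ n"
    by (intro power_mono exp_le) simp
  finally show ?thesis
    by (simp add: field_simps)
qed

text \<open>A union bound over all rectangles \<open>S \<times> T\<close> with sides of size at most \<open>K\<close>, given as the
  ranges of two lists, all values \<open>a\<close>, and all \<open>t\<close>-element sets of points of \<open>S \<times> T\<close> that take the
  value \<open>a\<close>.\<close>

lemma balanced_function_exists:
  fixes L K D t :: nat
  assumes "L ^ K * L ^ K * D * (K * K choose t) < D ^ t" "0 < t"
  shows "\<exists>E. (\<forall>u<L. \<forall>v<L. E (u, v) < D) \<and>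
    (\<forall>S T a. S \<subseteq> {..<L} \<longrightarrow> T \<subseteq> {..<L} \<longrightarrow> a < D \<longrightarrow> card S \<le> K \<longrightarrow> card T \<le> K \<longrightarrow>
      card {p \<in> S \<times> T. E p = a} < t)"
proof -
  define I where "I = {..<L} \<times> {..<L}"
  define \<Phi> where "\<Phi> = I \<rightarrow>\<^sub>E {..<D}"
  define lists where "lists = {xs. set xs \<subseteq> {..<L} \<and> length xs = K}"
  define con where "con = (\<lambda>Q a. {E \<in> \<Phi>. \<forall>p\<in>Q. E p = a})"
  define bad where "bad = (\<Union>xs\<in>lists. \<Union>ys\<in>lists. \<Union>a\<in>{..<D}.
    \<Union>Q\<in>{Q. Q \<subseteq> set xs \<times> set ys \<and> card Q = t}. con Q a)"
  have I: "finite I" by (simp add: I_def)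
  have fin\<Phi>: "finite \<Phi>" and card\<Phi>: "card \<Phi> = D ^ card I"
    using I by (auto simp: \<Phi>_def card_PiE intro!: finite_PiE)
  have finl: "finite lists" and cardl: "card lists = L ^ K"
    using finite_lists_length_eq[of "{..<L}" K] card_lists_length_eq[of "{..<L}" K] by (auto simp: lists_def)
  \<comment> \<open>Prescribing the value at \<open>t\<close> points leaves a fraction
    \<open>1 / D ^ t\<close> of all functions.\<close>
  have card_con: "card (con Q a) * D ^ t \<le> card \<Phi>" if "Q \<subseteq> I" "card Q = t" "a < D" for Q a
  proof -
    have "con Q a = (\<Pi>\<^sub>E p\<in>I. if p \<in> Q then {a} else {..<D})"
    proof (rule set_eqI)
      fix E
      have "(\<forall>p\<in>I. E p \<in> (if p \<in> Q then {a} else {..<D})) \<longleftrightarrow> (\<forall>p\<in>I. E p < D) \<and> (\<forall>p\<in>Q. E p = a)"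
        using that by (auto split: if_splits)
      then show "E \<in> con Q a \<longleftrightarrow> E \<in> (\<Pi>\<^sub>E p\<in>I. if p \<in> Q then {a} else {..<D})"
        by (simp add: con_def \<Phi>_def PiE_iff conj_ac)
    qed
    then have "card (con Q a) = (\<Prod>p\<in>I. if p \<in> Q then 1 else D)"
      using I by (simp add: card_PiE if_distrib cong: if_cong)
    also have "\<dots> = D ^ card (I - Q)"
      using I by (simp add: prod.If_cases Diff_eq)
    finally show ?thesis
      using that I card_mono[OF I that(1)]
      by (simp add: card\<Phi> card_Diff_subset finite_subset flip: power_add)
  qed
  have "card bad * D ^ t \<le> (\<Sum>xs\<in>lists. \<Sum>ys\<in>lists. \<Sum>a<D.
      \<Sum>Q\<in>{Q. Q \<subseteq> set xs \<times> set ys \<and> card Q = t}. card (con Q a)) * D ^ t"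
    unfolding bad_def
    by (intro mult_right_mono order.trans[OF card_UN_le] sum_mono finl) (auto simp: finite_subset[OF _ finite_cartesian_product])
  also have "\<dots> = (\<Sum>xs\<in>lists. \<Sum>ys\<in>lists. \<Sum>a<D.
      \<Sum>Q\<in>{Q. Q \<subseteq> set xs \<times> set ys \<and> card Q = t}. card (con Q a) * D ^ t)"
    by (simp add: sum_distrib_right)
  also have "\<dots> \<le> (\<Sum>xs\<in>lists. \<Sum>ys\<in>lists. \<Sum>a<D. (K * K choose t) * card \<Phi>)"
  proof (intro sum_mono)
    fix xs ys a
    assume *: "xs \<in> lists" "ys \<in> lists" "a \<in> {..<D}"
    let ?Q = "{Q. Q \<subseteq> set xs \<times> set ys \<and> card Q = t}"
    have "(\<Sum>Q\<in>?Q. card (con Q a) * D ^ t) \<le> (\<Sum>Q\<in>?Q. card \<Phi>)"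
      using * by (intro sum_mono card_con) (auto simp: lists_def I_def)
    also have "\<dots> = (card (set xs \<times> set ys) choose t) * card \<Phi>"
      by (simp add: n_subsets)
    also have "\<dots> \<le> (K * K choose t) * card \<Phi>"
      using * card_length[of xs] card_length[of ys]
      by (intro mult_right_mono binomial_right_mono) (auto simp: lists_def card_cartesian_product intro!: mult_mono)
    finally show "(\<Sum>Q\<in>?Q. card (con Q a) * D ^ t) \<le> (K * K choose t) * card \<Phi>" .
  qed
  also have "\<dots> = L ^ K * L ^ K * D * (K * K choose t) * card \<Phi>"
    by (simp add: cardl)
  finally have card_bad: "card bad * D ^ t \<le> L ^ K * L ^ K * D * (K * K choose t) * card \<Phi>" .
  have "\<not> \<Phi> \<subseteq> bad"
  proof
    assume "\<Phi> \<subseteq> bad"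
    moreover have "bad \<subseteq> \<Phi>" by (auto simp: bad_def con_def)
    ultimately have "bad = \<Phi>" by simp
    with card_bad have "D ^ t * card \<Phi> \<le> L ^ K * L ^ K * D * (K * K choose t) * card \<Phi>"
      by (simp add: mult.commute)
    moreover have "0 < card \<Phi>"
      using assms by (cases "D = 0") (auto simp: card\<Phi>)
    ultimately show False using assms by simp
  qed
  then obtain E where E: "E \<in> \<Phi>" "E \<notin> bad" by blast
  have "card {p \<in> S \<times> T. E p = a} < t"
    if ST: "S \<subseteq> {..<L}" "T \<subseteq> {..<L}" "a < D" "card S \<le> K" "card T \<le> K" for S T a
  proof (rule ccontr)
    assume "\<not> ?thesis"
    then obtain Q where Q: "Q \<subseteq> {p \<in> S \<times> T. E p = a}" "card Q = t"
      by (meson not_less obtain_subset_with_card_n)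
    \<comment> \<open>Lists of length exactly \<open>K\<close> may repeat entries, so they cover all
      smaller sets; a nonempty set provides the padding element.\<close>
    have list: "\<exists>xs\<in>lists. A \<subseteq> set xs" if A: "A \<subseteq> {..<L}" "card A \<le> K" "A \<noteq> {}" for A
    proof -
      have "finite A"
        using A(1) finite_subset by blast
      then obtain zs where zs: "set zs = A" "length zs = card A"
        using finite_distinct_list distinct_card by metis
      obtain x where "x \<in> A" using A(3) by blast
      with zs A show ?thesis
        by (intro bexI[of _ "zs @ replicate (K - card A) x"]) (auto simp: lists_def)
    qed
    have "S \<noteq> {}" "T \<noteq> {}"
      using Q assms(2) by auto
    with list ST obtain xs ys where "xs \<in> lists" "ys \<in> lists" "S \<subseteq> set xs" "T \<subseteq> set ys"
      by meson
    moreover from this Q have "Q \<subseteq> set xs \<times> set ys" "E \<in> con Q a"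
      using E(1) by (auto simp: con_def)
    ultimately have "E \<in> bad"
      using ST(3) Q(2) unfolding bad_def by blast
    with E(2) show False by blast
  qed
  moreover have "E (u, v) < D" if "u < L" "v < L" for u v
    using E(1) that by (auto simp: \<Phi>_def I_def)
  ultimately show ?thesis by blast
qed

text \<open>Bounded quantifiers over bit masks make the definition decidable; for counting, the form
  with sets is needed.\<close>

lemma balanced_iff:
  "balanced R e \<longleftrightarrow> (\<forall>S T a. S \<subseteq> {..<2 ^ (R ^ 2)} \<longrightarrow> T \<subseteq> {..<2 ^ (R ^ 2)} \<longrightarrow> a < 2 ^ R \<longrightarrow>
     card S \<le> 8 ^ R \<longrightarrow> card T \<le> 8 ^ R \<longrightarrow>
     (\<Sum>u\<in>S. \<Sum>v\<in>T. of_bool (entry R e u v = a)) \<le> (2::nat) ^ (5 * R + 3))" (is "_ \<longleftrightarrow> ?rhs")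
proof -
  let ?L = "2 ^ (R ^ 2) :: nat"
  let ?S = "\<lambda>B. {u. u < ?L \<and> B div 2 ^ u mod 2 = 1}"
  have count: "(\<Sum>u<?L. of_bool (B div 2 ^ u mod 2 = 1)) = card (?S B)" for B :: nat
    by (subst sum_of_bool_eq) (auto intro!: arg_cong[of _ _ card])
  have rect: "(\<Sum>u<?L. \<Sum>v<?L. of_bool (B div 2 ^ u mod 2 = 1 \<and> C div 2 ^ v mod 2 = 1 \<and> entry R e u v = a)) =
      (\<Sum>u\<in>?S B. \<Sum>v\<in>?S C. of_bool (entry R e u v = a) :: nat)" for B C a :: nat
  proof -
    let ?b = "\<lambda>B u. (B::nat) div 2 ^ u mod 2 = 1"
    have "(\<Sum>u<?L. \<Sum>v<?L. of_bool (?b B u \<and> ?b C v \<and> entry R e u v = a)) =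
        (\<Sum>u<?L. \<Sum>v<?L. if ?b B u then if ?b C v then of_bool (entry R e u v = a) else 0 else (0::nat))"
      by (intro sum.cong refl) simp
    also have "\<dots> = (\<Sum>u<?L. if ?b B u then \<Sum>v<?L. if ?b C v then of_bool (entry R e u v = a) else 0 else 0)"
    proof (intro sum.cong refl)
      show "(\<Sum>v<?L. if ?b B u then if ?b C v then of_bool (entry R e u v = a) else 0 else 0) =
          (if ?b B u then \<Sum>v<?L. if ?b C v then of_bool (entry R e u v = a) else 0 else (0::nat))" for u
        by (cases "?b B u") (simp_all only: simp_thms if_True if_False sum.neutral_const)
    qed
    also have "\<dots> = (\<Sum>u\<in>{u \<in> {..<?L}. ?b B u}. \<Sum>v\<in>{v \<in> {..<?L}. ?b C v}. of_bool (entry R e u v = a))"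
      by (simp only: sum.inter_filter[OF finite_lessThan])
    also have "\<dots> = (\<Sum>u\<in>?S B. \<Sum>v\<in>?S C. of_bool (entry R e u v = a))"
      by (simp only: lessThan_iff)
    finally show ?thesis .
  qed
  show ?thesis
  proof
    assume bal: "balanced R e"
    show ?rhs
    proof (intro allI impI)
      fix S T :: "nat set" and a :: nat
      assume *: "S \<subseteq> {..<?L}" "T \<subseteq> {..<?L}" "a < 2 ^ R" "card S \<le> 8 ^ R" "card T \<le> 8 ^ R"
      obtain B :: nat where B: "B < 2 ^ ?L" "\<And>u. u < ?L \<Longrightarrow> B div 2 ^ u mod 2 = 1 \<longleftrightarrow> u \<in> S"
        using bitmask_exists[of "?L" S] by blast
      obtain C :: nat where C: "C < 2 ^ ?L" "\<And>u. u < ?L \<Longrightarrow> C div 2 ^ u mod 2 = 1 \<longleftrightarrow> u \<in> T"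
        using bitmask_exists[of "?L" T] by blast
      have eq: "?S B = S" "?S C = T"
        using B(2) C(2) *(1,2) by blast+
      show "(\<Sum>u\<in>S. \<Sum>v\<in>T. of_bool (entry R e u v = a)) \<le> (2::nat) ^ (5 * R + 3)"
        using bal[unfolded balanced_def count rect, rule_format, OF B(1) C(1) *(3)] *(4,5)
        unfolding eq by blast
    qed
  next
    assume rhs: ?rhs
    have "?S B \<subseteq> {..<?L}" for B :: nat by auto
    with rhs show "balanced R e"
      unfolding balanced_def count rect by blast
  qed
qed

text \<open>Put \<open>t = 8 * K * K / D\<close>. The rectangles and values number at most
  \<open>L ^ K * L ^ K * D < 2 ^ t\<close>, because \<open>R ^ 2 \<le> 4 ^ R\<close>. The choices of
  \<open>t\<close> points number at most \<open>(K * K) ^ t / t!\<close>, which is at most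
  \<open>(3 * D / 8) ^ t\<close>. The union bound works since \<open>2 * 3 < 8\<close>.\<close>

theorem balanced_exists: "\<exists>e. balanced R e"
proof -
  define L K D t :: nat where "L = 2 ^ (R ^ 2)" and "K = 8 ^ R" and "D = 2 ^ R" and "t = 2 ^ (5 * R + 3)"
  have K_eq: "K = 2 ^ (3 * R)" by (simp add: K_def power_mult)
  have "0 < K" "0 < t" by (simp_all add: K_def t_def)
  have small: "L ^ K * L ^ K * D < 2 ^ t"
  proof -
    have "R < 2 ^ R" by (rule less_exp)
    then have "R ^ 2 \<le> 2 ^ R * 2 ^ R"
      unfolding power2_eq_square by (intro mult_mono) auto
    then have "R ^ 2 * K \<le> 2 ^ R * 2 ^ R * 2 ^ (3 * R)"
      unfolding K_eq by (intro mult_right_mono) auto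
    also have "\<dots> = 2 ^ (5 * R)"
      by (simp flip: power_add)
    finally have "R ^ 2 * K + R ^ 2 * K + R < 8 * 2 ^ (5 * R)"
      using order.strict_trans2[OF less_exp power_increasing[of R "5 * R" "2::nat"]] by simp
    also have "\<dots> = t" by (simp add: t_def power_add)
    finally show ?thesis
      unfolding L_def D_def by (simp flip: power_mult power_add)
  qed
  have choose: "(K * K choose t) * 8 ^ t \<le> 3 ^ t * D ^ t"
  proof -
    have tD: "t * D = 8 * (K * K)"
      by (simp add: t_def D_def K_eq flip: power_add) (simp add: power_add)
    have "real (K * K choose t) * real t ^ t \<le> real (K * K choose t) * (3 ^ t * fact t)"
      by (intro mult_left_mono power_le_fact) simp
    also have "\<dots> = 3 ^ t * real ((K * K choose t) * fact t)" by simp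
    also have "\<dots> \<le> 3 ^ t * real ((K * K) ^ t)"
      by (intro mult_left_mono of_nat_mono binomial_fact_pow) simp
    finally have "real ((K * K choose t) * t ^ t) \<le> real (3 ^ t * (K * K) ^ t)"
      by simp
    then have "(K * K choose t) * t ^ t \<le> 3 ^ t * (K * K) ^ t"
      by (simp only: of_nat_le_iff)
    then have "(K * K choose t) * t ^ t * D ^ t \<le> 3 ^ t * (K * K) ^ t * D ^ t"
      by (rule mult_right_mono) simp
    then have "(K * K choose t) * (t * D) ^ t \<le> (3 ^ t * D ^ t) * (K * K) ^ t"
      by (simp add: power_mult_distrib mult_ac)
    then have "((K * K choose t) * 8 ^ t) * (K * K) ^ t \<le> (3 ^ t * D ^ t) * (K * K) ^ t"
      unfolding tD by (simp add: power_mult_distrib mult_ac)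
    then show ?thesis using \<open>0 < K\<close> by simp
  qed
  from small have "L ^ K * L ^ K * D * (3 ^ t * D ^ t) < 2 ^ t * (3 ^ t * D ^ t)"
    by (intro mult_strict_right_mono) (simp_all add: D_def)
  then have "L ^ K * L ^ K * D * ((K * K choose t) * 8 ^ t) < 2 ^ t * (3 ^ t * D ^ t)"
    by (rule le_less_trans[OF mult_left_mono[OF choose], rotated]) simp
  also have "\<dots> = 6 ^ t * D ^ t"
    using power_mult_distrib[of "2::nat" 3 t] by simp
  also have "\<dots> \<le> 8 ^ t * D ^ t"
    by (intro mult_right_mono power_mono) auto
  finally have "(L ^ K * L ^ K * D * (K * K choose t)) * 8 ^ t < D ^ t * 8 ^ t"
    by (simp only: mult_ac)
  then have "L ^ K * L ^ K * D * (K * K choose t) < D ^ t"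
    unfolding mult_less_cancel2 by (rule conjunct2)
  from balanced_function_exists[OF this \<open>0 < t\<close>] obtain E where
    E: "\<And>u v. u < L \<Longrightarrow> v < L \<Longrightarrow> E (u, v) < D"
      "\<And>S T a. S \<subseteq> {..<L} \<Longrightarrow> T \<subseteq> {..<L} \<Longrightarrow> a < D \<Longrightarrow> card S \<le> K \<Longrightarrow> card T \<le> K \<Longrightarrow>
        card {p \<in> S \<times> T. E p = a} < t"
    by blast
  obtain e where e: "\<And>u v. u < L \<Longrightarrow> v < L \<Longrightarrow> entry R e u v = E (u, v)"
    using entry_exists[of R "\<lambda>u v. E (u, v)"] E(1) unfolding L_def D_def by blast
  have "balanced R e"
    unfolding balanced_iff
  proof (intro allI impI)
    fix S T :: "nat set" and a :: nat
    assume "S \<subseteq> {..<2 ^ (R ^ 2)}" "T \<subseteq> {..<2 ^ (R ^ 2)}" "a < 2 ^ R" "card S \<le> 8 ^ R" "card T \<le> 8 ^ R"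
    then have *: "S \<subseteq> {..<L}" "T \<subseteq> {..<L}" "a < D" "card S \<le> K" "card T \<le> K"
      by (simp_all add: L_def D_def K_def)
    have fin: "finite S" "finite T"
      using * finite_subset[of _ "{..<L}"] by auto
    have "(\<Sum>u\<in>S. \<Sum>v\<in>T. of_bool (entry R e u v = a)) = (\<Sum>u\<in>S. \<Sum>v\<in>T. of_bool (E (u, v) = a) :: nat)"
      using e *(1,2) by (intro sum.cong refl) (metis lessThan_iff subsetD)
    also have "\<dots> = (\<Sum>p\<in>S \<times> T. of_bool (E p = a))"
      unfolding sum.cartesian_product by (intro sum.cong refl) (simp only: split_beta prod.collapse)
    also have "\<dots> = card ((S \<times> T) \<inter> {p. E p = a})"
      using fin by (simp only: sum_of_bool_eq finite_cartesian_product of_nat_id)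
    also have "(S \<times> T) \<inter> {p. E p = a} = {p \<in> S \<times> T. E p = a}" by blast
    also have "card {p \<in> S \<times> T. E p = a} \<le> t"
      by (rule less_imp_le[OF E(2)[OF *]])
    finally show "(\<Sum>u\<in>S. \<Sum>v\<in>T. of_bool (entry R e u v = a)) \<le> (2::nat) ^ (5 * R + 3)"
      by (simp add: t_def)
  qed
  then show ?thesis by blast
qed

section \<open>From small rectangles to weighted counts and two nested tables\<close>

lemma cover_bound:
  fixes \<phi> :: "'a \<Rightarrow> nat"
  assumes "finite U" "\<And>S. S \<subseteq> U \<Longrightarrow> card S \<le> K \<Longrightarrow> sum \<phi> S \<le> c"
  shows "S \<subseteq> U \<Longrightarrow> K * sum \<phi> S \<le> (card S + K) * c"
proof (induction "card S" arbitrary: S rule: less_induct)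
  case less
  have fin: "finite S" using less.prems assms(1) finite_subset by blast
  show ?case
  proof (cases "card S \<le> K \<or> K = 0")
    case True
    then show ?thesis
      using assms(2)[OF less.prems] by (auto intro!: mult_le_mono simp: add_mult_distrib intro: trans_le_add2)
  next
    case False
    \<comment> \<open>Pieces of exactly \<open>K\<close> elements are split off, each contributing
      at most \<open>c\<close>; the extra \<open>K\<close> in the bound pays for the last, possibly
      smaller piece.\<close>
    then obtain T where T: "T \<subseteq> S" "card T = K"
      using obtain_subset_with_card_n[of K S] by auto
    have card: "card (S - T) = card S - K"
      using T fin by (simp add: card_Diff_subset finite_subset)
    have "K * sum \<phi> S = K * sum \<phi> (S - T) + K * sum \<phi> T"
      using sum.subset_diff[OF T(1) fin, of \<phi>] by (simp add: add_mult_distrib2)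
    also have "\<dots> \<le> (card S - K + K) * c + K * c"
      using less.hyps[of "S - T"] False T less.prems assms(2)[of T] card
      by (intro add_mono) auto
    also have "\<dots> = (card S + K) * c"
      using False by (simp add: add_mult_distrib)
    finally show ?thesis .
  qed
qed

text \<open>Layer-cake: a weight with values in \<open>{0..P}\<close> is the sum of the indicator functions of its
  \<open>P\<close> superlevel sets.\<close>

lemma weighted_cover_bound:
  fixes \<phi> p :: "'a \<Rightarrow> nat"
  assumes "finite U" "\<And>S. S \<subseteq> U \<Longrightarrow> card S \<le> K \<Longrightarrow> sum \<phi> S \<le> c" "\<And>u. u \<in> U \<Longrightarrow> p u \<le> P"
  shows "K * (\<Sum>u\<in>U. p u * \<phi> u) \<le> (sum p U + K * P) * c"
proof -
  have p: "p u = (\<Sum>j<P. of_bool (j < p u))" if "u \<in> U" for u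
  proof -
    have "{..<P} \<inter> {j. j < p u} = {..<p u}" using assms(3)[OF that] by auto
    then show ?thesis by (simp add: sum_of_bool_eq)
  qed
  have level: "(\<Sum>u\<in>U. of_bool (j < p u) * \<phi> u) = sum \<phi> {u \<in> U. j < p u}" for j
    unfolding sum.inter_filter[OF assms(1)] by (intro sum.cong refl) simp
  have levelp: "(\<Sum>u\<in>U. of_bool (j < p u)) = card {u \<in> U. j < p u}" for j
    using assms(1) by (subst sum_of_bool_eq) (auto simp: Int_def)
  have "K * (\<Sum>u\<in>U. p u * \<phi> u) = K * (\<Sum>u\<in>U. \<Sum>j<P. of_bool (j < p u) * \<phi> u)"
    using p by (intro arg_cong[of _ _ "(*) K"] sum.cong refl) (metis sum_distrib_right)
  also have "\<dots> = (\<Sum>j<P. K * sum \<phi> {u \<in> U. j < p u})"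
    by (subst sum.swap) (simp add: level sum_distrib_left)
  also have "\<dots> \<le> (\<Sum>j<P. (card {u \<in> U. j < p u} + K) * c)"
    using assms(1,2) by (intro sum_mono cover_bound) auto
  also have "\<dots> = ((\<Sum>j<P. \<Sum>u\<in>U. of_bool (j < p u)) + K * P) * c"
    unfolding levelp by (simp add: sum.distrib mult.commute[of K] flip: sum_distrib_right)
  also have "(\<Sum>j<P. \<Sum>u\<in>U. of_bool (j < p u)) = sum p U"
    by (subst sum.swap) (use p in simp)
  finally show ?thesis .
qed

text \<open>\<open>weighted_cover_bound\<close> is applied once per side: first to weighted columns
  against a small set of rows, then to weighted rows. The weights will be numbers of extensions of
  short prefixes.\<close>

lemma balanced_weighted:
  assumes "balanced R e" "A \<subseteq> {..<2 ^ R}"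
    and "\<And>u. u < 2 ^ (R ^ 2) \<Longrightarrow> p u \<le> P" "\<And>v. v < 2 ^ (R ^ 2) \<Longrightarrow> q v \<le> Q"
  shows "2 ^ R * (\<Sum>u<2 ^ (R ^ 2). \<Sum>v<2 ^ (R ^ 2). p u * q v * of_bool (entry R e u v \<in> A)) \<le>
    8 * card A * ((\<Sum>u<2 ^ (R ^ 2). p u) + 8 ^ R * P) * ((\<Sum>v<2 ^ (R ^ 2). q v) + 8 ^ R * Q)"
    (is "_ * ?X \<le> 8 * _ * ?p * ?q")
proof -
  define U :: "nat set" where "U = {..<2 ^ (R ^ 2)}"
  define K :: nat where "K = 8 ^ R"
  define \<psi> :: "nat \<Rightarrow> nat \<Rightarrow> nat" where "\<psi> u v = of_bool (entry R e u v \<in> A)" for u v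
  define p' q' where "p' = ?p" and "q' = ?q"
  define c :: nat where "c = card A * 2 ^ (5 * R + 3)"
  have finA: "finite A" using assms(2) finite_subset by blast
  have \<psi>: "\<psi> u v = (\<Sum>a\<in>A. of_bool (entry R e u v = a))" for u v
    using finA by (simp add: \<psi>_def of_bool_def)
  have flat: "(\<Sum>v\<in>T. \<Sum>u\<in>S. \<psi> u v) \<le> c" if "S \<subseteq> U" "T \<subseteq> U" "card S \<le> K" "card T \<le> K" for S T
  proof -
    have "(\<Sum>v\<in>T. \<Sum>u\<in>S. \<psi> u v) = (\<Sum>u\<in>S. \<Sum>v\<in>T. \<Sum>a\<in>A. of_bool (entry R e u v = a))"
      unfolding \<psi> by (rule sum.swap)
    also have "\<dots> = (\<Sum>u\<in>S. \<Sum>a\<in>A. \<Sum>v\<in>T. of_bool (entry R e u v = a))"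
      by (intro sum.cong refl sum.swap)
    also have "\<dots> = (\<Sum>a\<in>A. \<Sum>u\<in>S. \<Sum>v\<in>T. of_bool (entry R e u v = a))"
      by (rule sum.swap)
    also have "\<dots> \<le> (\<Sum>a\<in>A. 2 ^ (5 * R + 3))"
      using that assms(1,2) unfolding balanced_iff U_def K_def by (intro sum_mono) blast
    finally show ?thesis by (simp add: c_def)
  qed
  \<comment> \<open>The function summed over the rows is \<open>K\<close> times the weighted column
    sum, and its bound on small row sets is the inner application.\<close>
  have "K * (\<Sum>u\<in>U. p u * (K * (\<Sum>v\<in>U. q v * \<psi> u v))) \<le> p' * (q' * c)"
    unfolding p'_def q'_def U_def[symmetric] K_def[symmetric]
  proof (rule weighted_cover_bound)
    fix S
    assume S: "S \<subseteq> U" "card S \<le> K"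
    have "(\<Sum>u\<in>S. K * (\<Sum>v\<in>U. q v * \<psi> u v)) = K * (\<Sum>v\<in>U. q v * (\<Sum>u\<in>S. \<psi> u v))"
      unfolding sum_distrib_left by (subst sum.swap) (rule refl)
    also have "\<dots> \<le> (sum q U + K * Q) * c"
      using flat S assms(4) by (intro weighted_cover_bound) (auto simp: U_def)
    finally show "(\<Sum>u\<in>S. K * (\<Sum>v\<in>U. q v * \<psi> u v)) \<le> (sum q U + K * Q) * c" .
  qed (use assms(3) in \<open>auto simp: U_def\<close>)
  also have "K * (\<Sum>u\<in>U. p u * (K * (\<Sum>v\<in>U. q v * \<psi> u v))) = K * K * ?X"
    unfolding U_def[symmetric] \<psi>_def by (simp add: sum_distrib_left mult_ac)
  also have "K * K = 2 ^ (5 * R) * 2 ^ R"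
  proof -
    have "K = 2 ^ (3 * R)" by (simp add: K_def power_mult)
    then show ?thesis by (simp flip: power_add)
  qed
  finally have "2 ^ (5 * R) * (2 ^ R * ?X) \<le> 2 ^ (5 * R) * (8 * card A * p' * q')"
    by (simp add: c_def power_add mult_ac)
  from this[unfolded mult_le_cancel1 p'_def q'_def] show ?thesis
    by (rule mp) simp
qed

text \<open>A number is determined by its free bits, those below \<open>i\<close> and those from
  \<open>n\<close> on.\<close>

lemma card_fixed_bits:
  assumes "i \<le> n" "n \<le> r"
  shows "card {a::nat. a < 2 ^ r \<and> (\<forall>l. i \<le> l \<longrightarrow> l < n \<longrightarrow> bit a l = b l)} \<le> 2 ^ (i + r - n)"
    (is "card ?M \<le> _")
proof -
  have "card ?M \<le> card ({..<2 ^ i} \<times> {..<2 ^ (r - n)} :: (nat \<times> nat) set)"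
  proof (rule card_inj_on_le)
    show "inj_on (\<lambda>a. (take_bit i a, drop_bit n a)) ?M"
    proof (rule inj_onI)
      fix a a'
      assume M: "a \<in> ?M" "a' \<in> ?M" and eq: "(take_bit i a, drop_bit n a) = (take_bit i a', drop_bit n a')"
      show "a = a'"
      proof (rule bit_eqI)
        fix l
        consider "l < i" | "i \<le> l" "l < n" | "n \<le> l" by linarith
        then show "bit a l = bit a' l"
        proof cases
          case 1
          then show ?thesis using eq by (metis Pair_inject bit_take_bit_iff)
        next
          case 2
          then show ?thesis using M by simp
        next
          case 3
          then have "bit a l = bit (drop_bit n a) (l - n)" "bit a' l = bit (drop_bit n a') (l - n)"
            by (simp_all add: bit_drop_bit_eq)
          then show ?thesis using eq by simp
        qed
      qed
    qed
    have "drop_bit n a < 2 ^ (r - n)" if "a < 2 ^ r" for a :: nat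
      using that assms by (simp add: drop_bit_eq_div less_mult_imp_div_less flip: power_add)
    then show "(\<lambda>a. (take_bit i a, drop_bit n a)) ` ?M \<subseteq> {..<2 ^ i} \<times> {..<2 ^ (r - n)}"
      by auto
  qed auto
  also have "\<dots> = 2 ^ (i + r - n)"
    using assms by (simp flip: power_add)
  finally show ?thesis .
qed

text \<open>Pairs are grouped by residues modulo \<open>L\<close>, which are the values of the short
  prefixes. The large table bounds each group by a product of row and column weights, and these
  products are then summed with the small table.\<close>

lemma two_level_bound:
  fixes R :: nat and B C :: "nat set" and P Q :: nat
  defines "L \<equiv> 2 ^ (R ^ 2)"
  assumes bal: "balanced R e" "balanced R' e'" and A: "A \<subseteq> {..<2 ^ R}" "A' \<subseteq> {..<2 ^ R'}"
    and BC: "B \<subseteq> {..<2 ^ (R' ^ 2)}" "C \<subseteq> {..<2 ^ (R' ^ 2)}"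
    and P: "\<And>v. v < L \<Longrightarrow> card {X \<in> B. X mod L = v} \<le> P"
    and Q: "\<And>w. w < L \<Longrightarrow> card {Y \<in> C. Y mod L = w} \<le> Q"
  shows "2 ^ R * 2 ^ R' * card {(X, Y) \<in> B \<times> C. entry R e (X mod L) (Y mod L) \<in> A \<and> entry R' e' X Y \<in> A'} \<le>
    64 * card A * card A' * (card B + L * 8 ^ R' + 8 ^ R * (P + 8 ^ R')) * (card C + L * 8 ^ R' + 8 ^ R * (Q + 8 ^ R'))"
    (is "_ * card ?W \<le> _")
proof -
  define K' :: nat where "K' = 8 ^ R'"
  define U :: "nat set" where "U = {..<2 ^ (R' ^ 2)}"
  \<comment> \<open>Including the additive error \<open>K'\<close> in the weights keeps the bound
    for each group a product.\<close>
  define p q where "p v = card {X \<in> B. X mod L = v} + K'" and "q w = card {Y \<in> C. Y mod L = w} + K'" for v w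
  define o1 o2 :: "nat \<Rightarrow> nat \<Rightarrow> nat" where "o1 v w = of_bool (entry R e v w \<in> A)"
    and "o2 X Y = of_bool (entry R' e' X Y \<in> A')" for v w X Y
  define N where "N v w = (\<Sum>X | X \<in> B \<and> X mod L = v. \<Sum>Y | Y \<in> C \<and> Y mod L = w. o2 X Y)" for v w
  have fin: "finite B" "finite C"
    using BC finite_subset by blast+
  have "0 < L" by (simp add: L_def)
  have group: "(\<Sum>v<L. \<Sum>X | X \<in> S \<and> X mod L = v. h X) = sum h S" if "finite S" for S :: "nat set" and h :: "nat \<Rightarrow> nat"
    using that \<open>0 < L\<close> by (intro sum.group) auto
  have "card ?W = card ((B \<times> C) \<inter> {z. entry R e (fst z mod L) (snd z mod L) \<in> A \<and> entry R' e' (fst z) (snd z) \<in> A'})"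
    by (rule arg_cong[of _ _ card]) auto
  also have "\<dots> = (\<Sum>z\<in>B \<times> C. of_bool (entry R e (fst z mod L) (snd z mod L) \<in> A \<and> entry R' e' (fst z) (snd z) \<in> A'))"
    using fin by (simp only: sum_of_bool_eq finite_cartesian_product of_nat_id)
  also have "\<dots> = (\<Sum>z\<in>B \<times> C. o1 (fst z mod L) (snd z mod L) * o2 (fst z) (snd z))"
    by (simp only: o1_def o2_def of_bool_conj)
  also have "\<dots> = (\<Sum>X\<in>B. \<Sum>Y\<in>C. o1 (X mod L) (Y mod L) * o2 X Y)"
    by (simp only: sum.cartesian_product case_prod_unfold)
  also have "\<dots> = (\<Sum>v<L. \<Sum>X | X \<in> B \<and> X mod L = v. \<Sum>w<L. \<Sum>Y | Y \<in> C \<and> Y mod L = w.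
      o1 (X mod L) (Y mod L) * o2 X Y)"
    by (simp only: group fin)
  also have "\<dots> = (\<Sum>v<L. \<Sum>X | X \<in> B \<and> X mod L = v. \<Sum>w<L. \<Sum>Y | Y \<in> C \<and> Y mod L = w. o1 v w * o2 X Y)"
    by (intro sum.cong refl) simp
  also have "\<dots> = (\<Sum>v<L. \<Sum>w<L. o1 v w * N v w)"
    unfolding N_def sum_distrib_left by (intro sum.cong refl sum.swap)
  finally have W: "card ?W = (\<Sum>v<L. \<Sum>w<L. o1 v w * N v w)" .
  \<comment> \<open>Here the large table is used with 0/1 weights, hence with maximal weight
    1.\<close>
  have N: "2 ^ R' * N v w \<le> 8 * card A' * p v * q w" for v w
  proof -
    let ?b = "\<lambda>X. of_bool (X \<in> {X \<in> B. X mod L = v}) :: nat" and ?c = "\<lambda>Y. of_bool (Y \<in> {Y \<in> C. Y mod L = w}) :: nat"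
    have sum_b: "(\<Sum>X\<in>U. of_bool (X \<in> {X \<in> S. X mod L = v}) * h X) = (\<Sum>X | X \<in> S \<and> X mod L = v. h X)"
      if "S \<subseteq> U" for S v and h :: "nat \<Rightarrow> nat"
    proof -
      have "(\<Sum>X\<in>U. of_bool (X \<in> {X \<in> S. X mod L = v}) * h X) = (\<Sum>X\<in>U. if X \<in> S \<and> X mod L = v then h X else 0)"
        by (intro sum.cong refl) simp
      also have "\<dots> = (\<Sum>X | X \<in> U \<and> X \<in> S \<and> X mod L = v. h X)"
        by (subst sum.inter_filter[symmetric]) (simp_all add: U_def)
      also have "{X. X \<in> U \<and> X \<in> S \<and> X mod L = v} = {X \<in> S. X mod L = v}"
        using that by blast
      finally show ?thesis .
    qed
    have BU: "B \<subseteq> U" "C \<subseteq> U" using BC by (auto simp: U_def)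
    have "2 ^ R' * (\<Sum>X\<in>U. \<Sum>Y\<in>U. ?b X * ?c Y * o2 X Y) \<le>
        8 * card A' * (sum ?b U + 8 ^ R' * 1) * (sum ?c U + 8 ^ R' * 1)"
      unfolding U_def o2_def by (rule balanced_weighted[OF bal(2) A(2)]) auto
    also have "(\<Sum>X\<in>U. \<Sum>Y\<in>U. ?b X * ?c Y * o2 X Y) = (\<Sum>X\<in>U. ?b X * (\<Sum>Y\<in>U. ?c Y * o2 X Y))"
      by (simp only: sum_distrib_left mult.assoc)
    also have "\<dots> = N v w"
      unfolding N_def by (simp only: sum_b BU)
    also have "sum ?b U + 8 ^ R' * 1 = p v"
      using sum_b[OF BU(1), of v "\<lambda>_. 1"] by (simp only: p_def K'_def mult_1_right card_eq_sum)
    also have "sum ?c U + 8 ^ R' * 1 = q w"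
      using sum_b[OF BU(2), of w "\<lambda>_. 1"] by (simp only: q_def K'_def mult_1_right card_eq_sum)
    finally show ?thesis .
  qed
  have sum_p: "(\<Sum>v<L. p v) = card B + L * K'"
    using group[OF fin(1), of "\<lambda>_. 1"] by (simp add: p_def sum.distrib)
  have sum_q: "(\<Sum>w<L. q w) = card C + L * K'"
    using group[OF fin(2), of "\<lambda>_. 1"] by (simp add: q_def sum.distrib)
  have "2 ^ R' * card ?W = (\<Sum>v<L. \<Sum>w<L. o1 v w * (2 ^ R' * N v w))"
    unfolding W sum_distrib_left by (simp only: mult.left_commute)
  also have "\<dots> \<le> (\<Sum>v<L. \<Sum>w<L. o1 v w * (8 * card A' * p v * q w))"
    by (intro sum_mono mult_left_mono N) simp
  also have "\<dots> = 8 * card A' * (\<Sum>v<L. \<Sum>w<L. p v * q w * o1 v w)"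
    unfolding sum_distrib_left by (simp only: mult_ac)
  finally have "2 ^ R * (2 ^ R' * card ?W) \<le> 2 ^ R * (8 * card A' * (\<Sum>v<L. \<Sum>w<L. p v * q w * o1 v w))"
    by (rule mult_left_mono) simp
  also have "\<dots> = 8 * card A' * (2 ^ R * (\<Sum>v<L. \<Sum>w<L. p v * q w * o1 v w))"
    by (simp only: mult_ac)
  also have "\<dots> \<le> 8 * card A' * (8 * card A * ((\<Sum>v<L. p v) + 8 ^ R * (P + K')) * ((\<Sum>w<L. q w) + 8 ^ R * (Q + K')))"
    unfolding L_def o1_def
    by (intro mult_left_mono balanced_weighted[OF bal(1) A(1)]) (use P Q in \<open>auto simp: p_def q_def L_def\<close>)
  finally show ?thesis
    unfolding sum_p sum_q by (simp only: mult_ac K'_def)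
qed

section \<open>Complexity with respect to a staged universal machine\<close>

text \<open>\<open>step s m\<close> is the result of the program with code \<open>m\<close> after
  \<open>s\<close> steps, with 0 for no output so far; thus strings of bounded complexity can be
  enumerated by stages.\<close>

locale staged_universal =
  fixes U :: "bool list \<Rightarrow> bool list option" and step :: "nat \<Rightarrow> nat \<Rightarrow> nat"
  assumes universal: "universal_machine U"
    and recursive_step': "recursive 2 (\<lambda>xs. step (xs ! 0) (xs ! 1))"
    and U_iff: "U w = Some v \<longleftrightarrow> (\<exists>s. step s (bstr_code w) = Suc (bstr_code v))"
    and step_mono: "step s m = Suc u \<Longrightarrow> s \<le> s' \<Longrightarrow> step s' m = Suc u"

lemma staged_universal_exists:
  assumes "universal_machine U"
  obtains step where "staged_universal U step"
proof -
  obtain r where r: "\<And>w v. U w = Some v \<longleftrightarrow> eval [] r [bstr_code w] (bstr_code v)"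
    using assms by (auto simp: universal_machine_def partial_computable_def)
  obtain g where "approximates 1 r g"
    using approximates_exists by blast
  then have rec: "recursive (Suc 1) (\<lambda>ys. g (ys ! 0) (tl ys))"
    and g: "\<And>m. (\<forall>v. eval [] r [m] v \<longleftrightarrow> (\<exists>s. g s [m] = Suc v)) \<and>
      (\<forall>s s' v. s \<le> s' \<longrightarrow> g s [m] = Suc v \<longrightarrow> g s' [m] = Suc v)"
    unfolding approximates_def by auto
  have "recursive 2 (\<lambda>ys. g (ys ! 0) [ys ! 1])"
  proof (rule recursive_cong)
    show "recursive 2 (\<lambda>ys. g (ys ! 0) (tl ys))"
      using rec by (simp add: numeral_2_eq_2)
    show "g (ys ! 0) (tl ys) = g (ys ! 0) [ys ! 1]" if "length ys = 2" for ys
      using that by (cases ys; cases "tl ys") auto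
  qed
  have "staged_universal U (\<lambda>s m. g s [m])"
  proof
    show "U w = Some v \<longleftrightarrow> (\<exists>s. g s [bstr_code w] = Suc (bstr_code v))" for w v
      unfolding r using g[of "bstr_code w"] by blast
    show "g s [m] = Suc u \<Longrightarrow> s \<le> s' \<Longrightarrow> g s' [m] = Suc u" for s s' m u
      using g[of m] by blast
  qed fact+
  then show ?thesis by (rule that)
qed

context staged_universal
begin

lemmas recursive_step [rec_intros] = recursive_apply2[of step, OF recursive_step']

text \<open>Determinism of \<open>eval\<close> and injectivity of \<open>bstr_code\<close> turn a
  term into a function on strings, to which universality applies.\<close>

lemma decoder_exists:
  obtains c where "\<And>p v. eval [] r [bstr_code p] (bstr_code v) \<Longrightarrow> \<exists>q. U q = Some v \<and> length q \<le> length p + c"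
proof -
  define V where "V p = (if \<exists>v. eval [] r [bstr_code p] (bstr_code v)
    then Some (SOME v. eval [] r [bstr_code p] (bstr_code v)) else None)" for p
  have V: "V p = Some v \<longleftrightarrow> eval [] r [bstr_code p] (bstr_code v)" for p v
  proof (cases "\<exists>v. eval [] r [bstr_code p] (bstr_code v)")
    case True
    then have "eval [] r [bstr_code p] (bstr_code (SOME v. eval [] r [bstr_code p] (bstr_code v)))"
      by (rule someI_ex)
    then show ?thesis
      using True eval_deterministic bstr_code_eq_iff unfolding V_def by (metis option.inject)
  qed (auto simp: V_def)
  then have "partial_computable V"
    unfolding partial_computable_def by blast
  then obtain c where "\<And>p v. V p = Some v \<Longrightarrow> \<exists>q. U q = Some v \<and> length q \<le> length p + c"
    using universal unfolding universal_machine_def by blast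
  then show ?thesis
    unfolding V by (rule that)
qed

section \<open>Upper bounds for plain complexity from descriptions\<close>

lemma KC_program: "\<exists>p. length p = KC U v \<and> U p = Some v"
proof -
  obtain c where "\<And>p v. eval [] (Proj 0) [bstr_code p] (bstr_code v) \<Longrightarrow> \<exists>q. U q = Some v \<and> length q \<le> length p + c"
    using decoder_exists by blast
  moreover have "eval [] (Proj 0) [bstr_code v] (bstr_code v)"
    using eval.eval_proj[of 0 "[bstr_code v]" "[]"] by simp
  ultimately have "\<exists>n p. length p = n \<and> U p = Some v"
    by blast
  from LeastI_ex[OF this] show ?thesis
    unfolding KC_def .
qed

lemma KC_le: "U p = Some v \<Longrightarrow> KC U v \<le> length p"
  unfolding KC_def by (intro Least_le) blast

lemma KC_decoder:
  obtains c where "\<And>m v. eval [] r [m] (bstr_code v) \<Longrightarrow> real (KC U v) \<le> lg m + c"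
proof -
  obtain c where c: "\<And>p v. eval [] r [bstr_code p] (bstr_code v) \<Longrightarrow> \<exists>q. U q = Some v \<and> length q \<le> length p + c"
    using decoder_exists by blast
  have "real (KC U v) \<le> lg m + real c" if ev: "eval [] r [m] (bstr_code v)" for m v
  proof -
    obtain p where p: "bstr_code p = m" by (rule bstr_code_surj)
    then obtain q where "U q = Some v" "length q \<le> length p + c"
      using c ev by blast
    then have "KC U v \<le> length p + c"
      using KC_le by fastforce
    then show ?thesis
      using lg_bstr_code(1)[of p] p by simp
  qed
  then show ?thesis by (rule that)
qed

text \<open>The constant depends on the enumeration \<open>h\<close> alone, so all varying lengths
  and complexities have to be passed in \<open>a\<close> or \<open>b\<close>.\<close>

lemma KC_describe:
  assumes "recursive 3 (\<lambda>xs. h (xs ! 0) (xs ! 1) (xs ! 2))"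
  obtains c where "\<And>a b j v. finite {w. \<exists>e. h a b e = Suc w} \<Longrightarrow> card {w. \<exists>e. h a b e = Suc w} \<le> 2 ^ j \<Longrightarrow>
      \<exists>e. h a b e = Suc (bstr_code v) \<Longrightarrow> real (KC U v) \<le> real j + lg b + 4 * (lg a + lg j) + c"
proof -
  obtain r where r: "\<And>a b j u. finite {w. \<exists>e. h a b e = Suc w} \<Longrightarrow> card {w. \<exists>e. h a b e = Suc w} \<le> 2 ^ j \<Longrightarrow>
      (\<exists>e. h a b e = Suc u) \<Longrightarrow> \<exists>m. eval [] r [m] u \<and> lg m \<le> real j + lg b + 4 * (lg a + lg j) + 3"
    using index_decoder[OF assms] by blast
  obtain c where c: "\<And>m v. eval [] r [m] (bstr_code v) \<Longrightarrow> real (KC U v) \<le> lg m + c"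
    using KC_decoder by blast
  show ?thesis
    by (rule that[of "3 + c"]) (use r c in fastforce)
qed

lemma KC_le_length:
  obtains c where "\<And>v. real (KC U v) \<le> real (length v) + c"
proof -
  obtain c where c: "\<And>m v. eval [] (Proj 0) [m] (bstr_code v) \<Longrightarrow> real (KC U v) \<le> lg m + c"
    using KC_decoder by blast
  have "real (KC U v) \<le> real (length v) + (1 + c)" for v
    using c[of "bstr_code v" v] eval.eval_proj[of 0 "[bstr_code v]" "[]"] lg_bstr_code(2)[of v] by simp
  then show ?thesis by (rule that)
qed

text \<open>The string of length \<open>N\<close> and value \<open>X\<close> is produced within \<open>s\<close> steps by a program of
  length at most \<open>k\<close>; the condition uses \<open>Suc_bstr_code\<close>.\<close>

definition simple :: "nat \<Rightarrow> nat \<Rightarrow> nat \<Rightarrow> nat \<Rightarrow> bool" where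
  "simple s N k X \<longleftrightarrow> (\<exists>p<2 ^ Suc k. step s p = 2 ^ N + X)"

text \<open>The first bit of a string is the least significant one, so \<open>X mod 2 ^ M\<close> is
  the value of its prefix of length \<open>M\<close>.\<close>

definition extensions :: "nat \<Rightarrow> nat \<Rightarrow> nat \<Rightarrow> nat \<Rightarrow> nat \<Rightarrow> nat" where
  "extensions s N k M v = (\<Sum>X<2 ^ N. of_bool (X mod 2 ^ M = v \<and> simple s N k X))"

lemma decidable_simple [rec_intros]:
  assumes "recursive k f" "recursive k g" "recursive k h" "recursive k l"
  shows "decidable k (\<lambda>xs. simple (f xs) (g xs) (h xs) (l xs))"
  unfolding decidable_def
proof (rule recursive_apply4[where h = "\<lambda>s N k X. of_bool (simple s N k X)", OF _ assms])
  show "recursive 4 (\<lambda>ys. of_bool (simple (ys ! 0) (ys ! 1) (ys ! 2) (ys ! 3)))"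
    unfolding simple_def by (intro rec_intros) simp_all
qed

lemma recursive_extensions [rec_intros]:
  assumes "recursive k f" "recursive k g" "recursive k h" "recursive k l" "recursive k j"
  shows "recursive k (\<lambda>xs. extensions (f xs) (g xs) (h xs) (l xs) (j xs))"
proof (rule recursive_apply5[where h = extensions, OF _ assms])
  show "recursive 5 (\<lambda>ys. extensions (ys ! 0) (ys ! 1) (ys ! 2) (ys ! 3) (ys ! 4))"
    unfolding extensions_def by (intro rec_intros) simp_all
qed

lemma extensions_eq_card: "extensions s N k M v = card {X. X < 2 ^ N \<and> X mod 2 ^ M = v \<and> simple s N k X}"
proof -
  have "{..<2 ^ N} \<inter> {X. X mod 2 ^ M = v \<and> simple s N k X} = {X. X < 2 ^ N \<and> X mod 2 ^ M = v \<and> simple s N k X}"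
    by auto
  then show ?thesis
    by (simp only: extensions_def sum_of_bool_eq finite_lessThan of_nat_id)
qed

lemma simple_mono: "simple s N k X \<Longrightarrow> s \<le> s' \<Longrightarrow> simple s' N k X"
  unfolding simple_def using step_mono by (metis Suc_pred add_gr_0 zero_less_numeral zero_less_power)

lemma step_unique: "step s m = Suc u \<Longrightarrow> step s' m = Suc u' \<Longrightarrow> u = u'"
  using step_mono by (metis nat.inject nat_le_linear)

lemma simple_KC:
  assumes "length w = N"
  shows "\<exists>s. simple s N (KC U w) (str_val w)"
proof -
  obtain p where p: "length p = KC U w" "U p = Some w"
    using KC_program by blast
  then obtain s where "step s (bstr_code p) = 2 ^ N + str_val w"
    using assms by (auto simp: U_iff Suc_bstr_code)
  moreover have "bstr_code p < 2 ^ Suc (KC U w)"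
    using Suc_bstr_code[of p] str_val_less[of p] p by simp
  ultimately show ?thesis
    unfolding simple_def by blast
qed

text \<open>Distinct values come from distinct programs, since \<open>step\<close> never revises an
  answer.\<close>

lemma card_simple: "card {X. X < 2 ^ N \<and> (\<exists>s. simple s N k X)} \<le> 2 ^ Suc k" (is "card ?B \<le> _")
proof -
  have "\<forall>X\<in>?B. \<exists>p. p < 2 ^ Suc k \<and> (\<exists>s. step s p = 2 ^ N + X)"
    unfolding simple_def by blast
  then obtain p where p: "\<And>X. X \<in> ?B \<Longrightarrow> p X < 2 ^ Suc k \<and> (\<exists>s. step s (p X) = 2 ^ N + X)"
    by metis
  have "card ?B \<le> card {..<2 ^ Suc k :: nat}"
  proof (rule card_inj_on_le)
    show "inj_on p ?B"
    proof (rule inj_onI)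
      fix X X'
      assume "X \<in> ?B" "X' \<in> ?B" "p X = p X'"
      then obtain s s' where "step s (p X) = 2 ^ N + X" "step s' (p X) = 2 ^ N + X'"
        using p by metis
      then have "2 ^ N + X - 1 = 2 ^ N + X' - 1"
        using step_unique[of s "p X" "2 ^ N + X - 1" s' "2 ^ N + X' - 1"] by simp
      moreover have "0 < (2::nat) ^ N" by simp
      ultimately show "X = X'" by linarith
    qed
    show "p ` ?B \<subseteq> {..<2 ^ Suc k}"
      using p by blast
  qed simp
  then show ?thesis by simp
qed

text \<open>Half of the symmetry of information.\<close>

lemma many_extensions:
  obtains c where "\<And>N M k \<alpha> v s. length v = M \<Longrightarrow> 2 ^ \<alpha> < extensions s N k M (str_val v) \<Longrightarrow>
    \<alpha> \<le> Suc k \<and> real (KC U v) \<le> real (Suc k - \<alpha>) +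
      4 * (lg (prod_encode (N, prod_encode (M, prod_encode (k, \<alpha>)))) + lg (Suc k - \<alpha>)) + c"
proof -
  \<comment> \<open>Prefixes with more than \<open>2 ^ \<alpha>\<close> simple extensions are
    enumerable. Their extension sets are disjoint, so there are at most
    \<open>2 ^ (Suc k - \<alpha>)\<close> such prefixes, and the rank of one of them describes
    it.\<close>
  define h where "h a b e = (let N = fst (prod_decode a); M = fst (prod_decode (snd (prod_decode a)));
      k = fst (prod_decode (snd (prod_decode (snd (prod_decode a)))));
      \<alpha> = snd (prod_decode (snd (prod_decode (snd (prod_decode a)))));
      s = fst (prod_decode e); v = snd (prod_decode e) in
      if v < 2 ^ M \<and> 2 ^ \<alpha> < extensions s N k M v then 2 ^ M + v else 0)" for a b e :: nat
  have "recursive 3 (\<lambda>xs. h (xs ! 0) (xs ! 1) (xs ! 2))"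
    unfolding h_def Let_def by (intro rec_intros) simp_all
  then obtain c where c: "\<And>a b j v. finite {w. \<exists>e. h a b e = Suc w} \<Longrightarrow> card {w. \<exists>e. h a b e = Suc w} \<le> 2 ^ j \<Longrightarrow>
      \<exists>e. h a b e = Suc (bstr_code v) \<Longrightarrow> real (KC U v) \<le> real j + lg b + 4 * (lg a + lg j) + c"
    using KC_describe by blast
  show ?thesis
  proof (rule that[of c])
    fix N M k \<alpha> v s
    assume len: "length v = M" and many: "2 ^ \<alpha> < extensions s N k M (str_val v)"
    define a where "a = prod_encode (N, prod_encode (M, prod_encode (k, \<alpha>)))"
    define V where "V = {u. u < 2 ^ M \<and> (\<exists>s. 2 ^ \<alpha> < extensions s N k M u)}"
    define B where "B = {X. X < 2 ^ N \<and> (\<exists>s. simple s N k X)}"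
    have h: "h a 0 (prod_encode (s, u)) = (if u < 2 ^ M \<and> 2 ^ \<alpha> < extensions s N k M u then 2 ^ M + u else 0)" for s u
      by (simp add: h_def a_def)
    have W: "{w. \<exists>e. h a 0 e = Suc w} \<subseteq> (\<lambda>u. 2 ^ M + u - 1) ` V"
    proof clarify
      fix w e
      assume w: "h a 0 e = Suc w"
      obtain s u where "e = prod_encode (s, u)" by (metis prod_decode_inverse surj_pair)
      with w h[of s u] show "w \<in> (\<lambda>u. 2 ^ M + u - 1) ` V"
        by (auto simp: V_def split: if_splits intro!: image_eqI[of _ _ u])
    qed
    have finV: "finite V" and finB: "finite B" by (simp_all add: V_def B_def)
    have "card V * 2 ^ \<alpha> = (\<Sum>u\<in>V. 2 ^ \<alpha>)" by simp
    also have "\<dots> \<le> (\<Sum>u\<in>V. card {X \<in> B. X mod 2 ^ M = u})"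
    proof (rule sum_mono)
      fix u
      assume "u \<in> V"
      then obtain s where "2 ^ \<alpha> < extensions s N k M u" by (auto simp: V_def)
      also have "\<dots> \<le> card {X \<in> B. X mod 2 ^ M = u}"
        unfolding extensions_eq_card using finB by (intro card_mono) (auto simp: B_def)
      finally show "2 ^ \<alpha> \<le> card {X \<in> B. X mod 2 ^ M = u}" by simp
    qed
    also have "\<dots> \<le> (\<Sum>u<2 ^ M. card {X \<in> B. X mod 2 ^ M = u})"
      by (intro sum_mono2) (auto simp: V_def)
    also have "\<dots> = card B"
      using finB sum.group[of B "{..<2 ^ M}" "\<lambda>X. X mod 2 ^ M" "\<lambda>_. 1::nat"] by (simp add: image_subset_iff)
    also have "\<dots> \<le> 2 ^ Suc k"
      unfolding B_def by (rule card_simple)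
    finally have card: "card V * 2 ^ \<alpha> \<le> 2 ^ Suc k" .
    \<comment> \<open>The given prefix belongs to \<open>V\<close>. So \<open>V\<close> is nonempty,
      which gives \<open>\<alpha> \<le> Suc k\<close> and makes the truncated subtraction
      exact.\<close>
    have v: "str_val v \<in> V"
      using many str_val_less[of v] len by (auto simp: V_def)
    then have "1 \<le> card V"
      using finV by (metis One_nat_def Suc_leI card_gt_0_iff empty_iff)
    then have "2 ^ \<alpha> \<le> card V * 2 ^ \<alpha>" by simp
    then have "(2::nat) ^ \<alpha> \<le> 2 ^ Suc k"
      using card by (rule order.trans)
    then have \<alpha>: "\<alpha> \<le> Suc k"
      by (rule power_le_imp_le_exp[rotated]) simp
    then have "card V * 2 ^ \<alpha> \<le> 2 ^ (Suc k - \<alpha>) * 2 ^ \<alpha>"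
      using card by (simp only: le_add_diff_inverse2 flip: power_add)
    then have "card V \<le> 2 ^ (Suc k - \<alpha>)" by simp
    then have "card {w. \<exists>e. h a 0 e = Suc w} \<le> 2 ^ (Suc k - \<alpha>)"
      by (rule order.trans[OF order.trans[OF card_mono[OF finite_imageI[OF finV] W] card_image_le[OF finV]]])
    moreover have "\<exists>e. h a 0 e = Suc (bstr_code v)"
    proof
      show "h a 0 (prod_encode (s, str_val v)) = Suc (bstr_code v)"
        unfolding h Suc_bstr_code using many str_val_less[of v] len by simp
    qed
    moreover have "finite {w. \<exists>e. h a 0 e = Suc w}"
      using W finV finite_surj by blast
    ultimately have "real (KC U v) \<le> real (Suc k - \<alpha>) + lg 0 + 4 * (lg a + lg (Suc k - \<alpha>)) + c"
      by (intro c)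
    then show "\<alpha> \<le> Suc k \<and> real (KC U v) \<le> real (Suc k - \<alpha>) +
      4 * (lg (prod_encode (N, prod_encode (M, prod_encode (k, \<alpha>)))) + lg (Suc k - \<alpha>)) + c"
      using \<alpha> by (simp add: lg_def a_def)
  qed
qed

end

section \<open>The extractor\<close>

definition table :: "nat \<Rightarrow> nat" where
  "table R = (LEAST e. balanced R e)"

definition block_bit :: "nat \<Rightarrow> nat \<Rightarrow> nat \<Rightarrow> nat \<Rightarrow> bool" where
  "block_bit R X Y l \<longleftrightarrow> bit (entry R (table R) X Y) l"

text \<open>For square \<open>R\<close> this gives the output bits from position
  \<open>sqrt R\<close> up to \<open>R ^ 2\<close> from the values of the prefixes of length
  \<open>R ^ 4\<close>; the reduction restores the shorter prefixes read by the smaller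
  table.\<close>

definition two_blocks_bit :: "nat \<Rightarrow> nat \<Rightarrow> nat \<Rightarrow> nat \<Rightarrow> bool" where
  "two_blocks_bit R X Y l =
     (if l < R then block_bit R (X mod 2 ^ (R ^ 2)) (Y mod 2 ^ (R ^ 2)) l else block_bit (R ^ 2) X Y l)"

lemma balanced_table: "balanced R (table R)"
  unfolding table_def using balanced_exists by (rule LeastI_ex)

text \<open>The search always halts because balanced tables exist; the totality of the extractor
  rests on this.\<close>

lemma recursive_table [rec_intros]:
  assumes "recursive k f"
  shows "recursive k (\<lambda>xs. table (f xs))"
proof (rule recursive_apply1[of table, OF _ assms])
  have "decidable 2 (\<lambda>ys. balanced (tl ys ! 0) (ys ! 0))"
    unfolding balanced_def by (intro rec_intros) simp_all
  then show "recursive 1 (\<lambda>ys. table (ys ! 0))"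
    unfolding table_def using balanced_exists
    by (intro recursive_Least[of 1 "\<lambda>e ys. balanced (ys ! 0) e"]) (simp_all add: numeral_2_eq_2)
qed

lemma decidable_bit [rec_intros]:
  assumes "recursive k f" "recursive k g"
  shows "decidable k (\<lambda>xs. bit (f xs) (g xs))"
  unfolding bit_iff_odd odd_iff_mod_2_eq_one by (intro rec_intros assms)

lemma decidable_iff [rec_intros]:
  assumes "decidable k P" "decidable k Q"
  shows "decidable k (\<lambda>xs. P xs = Q xs)"
  unfolding iff_conv_conj_imp by (intro rec_intros assms)

lemma decidable_if [rec_intros]:
  assumes "decidable k P" "decidable k Q" "decidable k Q'"
  shows "decidable k (\<lambda>xs. if P xs then Q xs else Q' xs)"
  unfolding if_bool_eq_conj by (intro rec_intros assms)

lemma decidable_block_bit [rec_intros]: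
  assumes "recursive k f" "recursive k g" "recursive k h" "recursive k l"
  shows "decidable k (\<lambda>xs. block_bit (f xs) (g xs) (h xs) (l xs))"
  unfolding block_bit_def by (intro rec_intros assms)

lemma decidable_two_blocks_bit [rec_intros]:
  assumes "recursive k f" "recursive k g" "recursive k h" "recursive k l"
  shows "decidable k (\<lambda>xs. two_blocks_bit (f xs) (g xs) (h xs) (l xs))"
  unfolding two_blocks_bit_def by (intro rec_intros assms)

text \<open>The required bits leave \<open>2 ^ S\<close> admissible values in the small table and
  \<open>2 ^ (R + R ^ 2 - n)\<close> in the large one. The lower bounds on \<open>k1\<close> and
  \<open>k2\<close> ensure that the error terms of \<open>two_level_bound\<close> change the main
  term by a constant factor only.\<close>

lemma two_level_card_bound:
  fixes R :: nat and B C :: "nat set"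
  defines "N \<equiv> (R ^ 2) ^ 2"
  assumes n: "S \<le> R" "R \<le> n" "n \<le> R ^ 2"
    and B: "B \<subseteq> {..<2 ^ N}" "card B \<le> 2 ^ Suc k1" "\<And>v. card {X \<in> B. X mod 2 ^ (R ^ 2) = v} \<le> 2 ^ \<alpha>"
    and C: "C \<subseteq> {..<2 ^ N}" "card C \<le> 2 ^ Suc k2" "\<And>v. card {Y \<in> C. Y mod 2 ^ (R ^ 2) = v} \<le> 2 ^ \<beta>"
    and k: "6 * R ^ 2 \<le> k1" "6 * R ^ 2 \<le> k2" "3 * R + \<alpha> \<le> k1" "3 * R + \<beta> \<le> k2"
  shows "card {(X, Y) \<in> B \<times> C. \<forall>l<n. S \<le> l \<longrightarrow> two_blocks_bit R X Y l = bit Z l} \<le> 2 ^ (k1 + k2 + S + 12 - n)"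
    (is "card ?W \<le> _")
proof -
  define L :: nat where "L = 2 ^ (R ^ 2)"
  define A where "A = {a::nat. a < 2 ^ R \<and> (\<forall>l. S \<le> l \<longrightarrow> l < R \<longrightarrow> bit a l = bit Z l)}"
  define A' where "A' = {a::nat. a < 2 ^ (R ^ 2) \<and> (\<forall>l. R \<le> l \<longrightarrow> l < n \<longrightarrow> bit a l = bit Z l)}"
  define V where "V = {(X, Y) \<in> B \<times> C. entry R (table R) (X mod L) (Y mod L) \<in> A \<and>
    entry (R ^ 2) (table (R ^ 2)) X Y \<in> A'}"
  have fin: "finite B" "finite C"
    using B C finite_subset by blast+
  have R2: "R \<le> R ^ 2" by (cases R) (simp_all add: power2_eq_square)
  have "?W \<subseteq> V"
  proof clarify
    fix X Y
    assume XY: "X \<in> B" "Y \<in> C" and bits: "\<forall>l<n. S \<le> l \<longrightarrow> two_blocks_bit R X Y l = bit Z l"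
    have "bit (entry R (table R) (X mod L) (Y mod L)) l = bit Z l" if "S \<le> l" "l < R" for l
      using bits[rule_format, of l] n that by (simp add: two_blocks_bit_def block_bit_def L_def)
    moreover have "bit (entry (R ^ 2) (table (R ^ 2)) X Y) l = bit Z l" if "R \<le> l" "l < n" for l
      using bits[rule_format, of l] n that by (simp add: two_blocks_bit_def block_bit_def)
    ultimately show "(X, Y) \<in> V"
      unfolding V_def A_def A'_def using XY entry_less by blast
  qed
  moreover have "finite V"
    unfolding V_def by (rule finite_subset[OF _ finite_cartesian_product[OF fin]]) auto
  ultimately have "card ?W \<le> card V" by (intro card_mono)
  \<comment> \<open>The summands are at most 2, 1, 1 and 1 times \<open>2 ^ k\<close>; the second is
    \<open>2 ^ (4 * R ^ 2)\<close> and the last \<open>2 ^ (3 * R + 3 * R ^ 2)\<close>.\<close>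
  have factor: "card D + L * 8 ^ (R ^ 2) + 8 ^ R * (2 ^ \<gamma> + 8 ^ (R ^ 2)) \<le> 2 ^ (k + 3)"
    if "card D \<le> 2 ^ Suc k" "6 * R ^ 2 \<le> k" "3 * R + \<gamma> \<le> k" for D :: "nat set" and k \<gamma>
  proof -
    have 8: "(8::nat) ^ i = 2 ^ (3 * i)" for i by (simp add: power_mult)
    have "L * 8 ^ (R ^ 2) \<le> 2 ^ k"
      unfolding L_def 8 using that by (simp flip: power_add)
    moreover have "8 ^ R * 2 ^ \<gamma> \<le> (2::nat) ^ k"
      unfolding 8 using that by (simp flip: power_add)
    moreover have "8 ^ R * 8 ^ (R ^ 2) \<le> (2::nat) ^ k"
      unfolding 8 using that R2 by (simp flip: power_add)
    ultimately show ?thesis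
      using that(1) by (simp add: add_mult_distrib2 power_add)
  qed
  have "2 ^ R * 2 ^ (R ^ 2) * card V \<le> 64 * card A * card A' *
      (card B + L * 8 ^ (R ^ 2) + 8 ^ R * (2 ^ \<alpha> + 8 ^ (R ^ 2))) *
      (card C + L * 8 ^ (R ^ 2) + 8 ^ R * (2 ^ \<beta> + 8 ^ (R ^ 2)))"
    unfolding V_def L_def using B C
    by (intro two_level_bound balanced_table) (auto simp: A_def A'_def N_def)
  also have "\<dots> \<le> 64 * 2 ^ S * 2 ^ (R + R ^ 2 - n) * 2 ^ (k1 + 3) * 2 ^ (k2 + 3)"
    using card_fixed_bits[of S R R "bit Z"] card_fixed_bits[of R n "R ^ 2" "bit Z"] n B C k
    by (intro mult_le_mono order.refl factor) (simp_all add: A_def A'_def)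
  also have "\<dots> = 2 ^ (6 + S + (R + R ^ 2 - n) + (k1 + 3) + (k2 + 3))"
    by (simp add: power_add)
  \<comment> \<open>Here 12 arises as \<open>6 + 3 + 3\<close>. The truncated subtractions are exact
    because \<open>n \<le> R ^ 2 \<le> k1\<close>.\<close>
  also have "6 + S + (R + R ^ 2 - n) + (k1 + 3) + (k2 + 3) = R + R ^ 2 + (k1 + k2 + S + 12 - n)"
    using n k by simp
  also have "2 ^ \<dots> = 2 ^ R * 2 ^ (R ^ 2) * (2::nat) ^ (k1 + k2 + S + 12 - n)"
    by (simp only: power_add)
  finally have "card V \<le> 2 ^ (k1 + k2 + S + 12 - n)" by simp
  with \<open>card ?W \<le> card V\<close> show ?thesis by (rule order.trans)
qed

context staged_universal
begin

text \<open>The number of extensions of a prefix only grows with the stage, so the latest stage that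
  satisfies the condition sees all the strings counted here.\<close>

lemma card_trimmed:
  "card {X \<in> {X. X < 2 ^ N \<and> (\<exists>s. simple s N k X \<and> extensions s N k M (X mod 2 ^ M) \<le> 2 ^ \<alpha>)}. X mod 2 ^ M = v} \<le> 2 ^ \<alpha>"
    (is "card ?F \<le> _")
proof (cases "?F = {}")
  case False
  have fin: "finite ?F" by simp
  have "\<forall>X\<in>?F. \<exists>s. simple s N k X \<and> extensions s N k M v \<le> 2 ^ \<alpha>" by auto
  from bchoice[OF this] obtain \<sigma> where
    \<sigma>: "\<And>X. X \<in> ?F \<Longrightarrow> simple (\<sigma> X) N k X \<and> extensions (\<sigma> X) N k M v \<le> 2 ^ \<alpha>"
    by blast
  have "Max (\<sigma> ` ?F) \<in> \<sigma> ` ?F"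
    using fin False by (intro Max_in) auto
  then obtain X0 where X0: "X0 \<in> ?F" "Max (\<sigma> ` ?F) = \<sigma> X0" by blast
  have "\<sigma> X \<le> \<sigma> X0" if "X \<in> ?F" for X
    unfolding X0(2)[symmetric] using fin that by (intro Max_ge) auto
  then have "simple (\<sigma> X0) N k X" if "X \<in> ?F" for X
    using that \<sigma> simple_mono by blast
  then have "?F \<subseteq> {X. X < 2 ^ N \<and> X mod 2 ^ M = v \<and> simple (\<sigma> X0) N k X}"
    by blast
  then have "card ?F \<le> extensions (\<sigma> X0) N k M v"
    unfolding extensions_eq_card by (intro card_mono) auto
  then show ?thesis
    using \<sigma>[OF X0(1)] by linarith
next
  case True
  show ?thesis unfolding True by simp
qed

text \<open>Given a program for \<open>w\<close>, the pair of \<open>u\<close> and \<open>v\<close>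
  is described by its rank among the trimmed pairs that are mapped to \<open>w\<close>;
  \<open>two_level_card_bound\<close> limits the length of that rank.\<close>

lemma KC_pair_bound:
  obtains c where "\<And>S R n k1 k2 \<alpha> \<beta> u v w. S \<le> R \<Longrightarrow> R \<le> n \<Longrightarrow> n \<le> R ^ 2 \<Longrightarrow>
    length u = (R ^ 2) ^ 2 \<Longrightarrow> length v = (R ^ 2) ^ 2 \<Longrightarrow> length w = n \<Longrightarrow>
    (\<And>l. l < n \<Longrightarrow> S \<le> l \<Longrightarrow> two_blocks_bit R (str_val u) (str_val v) l = w ! l) \<Longrightarrow>
    KC U u = k1 \<Longrightarrow> KC U v = k2 \<Longrightarrow>
    (\<And>s. extensions s ((R ^ 2) ^ 2) k1 (R ^ 2) (str_val u mod 2 ^ (R ^ 2)) \<le> 2 ^ \<alpha>) \<Longrightarrow>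
    (\<And>s. extensions s ((R ^ 2) ^ 2) k2 (R ^ 2) (str_val v mod 2 ^ (R ^ 2)) \<le> 2 ^ \<beta>) \<Longrightarrow>
    6 * R ^ 2 \<le> k1 \<Longrightarrow> 6 * R ^ 2 \<le> k2 \<Longrightarrow> 3 * R + \<alpha> \<le> k1 \<Longrightarrow> 3 * R + \<beta> \<le> k2 \<Longrightarrow>
    real (KC U (u @ v)) \<le> real (k1 + k2 + S + 12 - n) + real (KC U w) +
      4 * (lg (prod_encode (S, prod_encode (R, prod_encode (n, prod_encode (k1, prod_encode (k2,
        prod_encode (\<alpha>, \<beta>))))))) + lg (k1 + k2 + S + 12 - n)) + c"
proof -
  \<comment> \<open>At stage \<open>s\<close> only the extensions seen so far are compared with the
    bounds. The hypotheses on \<open>extensions\<close> hold at every stage, so the pair of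
    \<open>u\<close> and \<open>v\<close> is never dropped.\<close>
  define cond where "cond S R n k1 k2 \<alpha> \<beta> b s X Y \<longleftrightarrow>
    X < 2 ^ (R ^ 2) ^ 2 \<and> Y < 2 ^ (R ^ 2) ^ 2 \<and> simple s ((R ^ 2) ^ 2) k1 X \<and> simple s ((R ^ 2) ^ 2) k2 Y \<and>
    extensions s ((R ^ 2) ^ 2) k1 (R ^ 2) (X mod 2 ^ (R ^ 2)) \<le> 2 ^ \<alpha> \<and>
    extensions s ((R ^ 2) ^ 2) k2 (R ^ 2) (Y mod 2 ^ (R ^ 2)) \<le> 2 ^ \<beta> \<and>
    2 ^ n \<le> step s b \<and> (\<forall>l<n. S \<le> l \<longrightarrow> two_blocks_bit R X Y l = bit (step s b - 2 ^ n) l)"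
    for S R n k1 k2 \<alpha> \<beta> b s X Y :: nat
  \<comment> \<open>By \<open>Suc_bstr_code\<close> the number returned is \<open>Suc\<close> of the
    code of the concatenation of the strings with values \<open>X\<close> and
    \<open>Y\<close>.\<close>
  define h where "h a b e = (let S = fst (prod_decode a); a1 = snd (prod_decode a);
      R = fst (prod_decode a1); a2 = snd (prod_decode a1);
      n = fst (prod_decode a2); a3 = snd (prod_decode a2);
      k1 = fst (prod_decode a3); a4 = snd (prod_decode a3);
      k2 = fst (prod_decode a4); a5 = snd (prod_decode a4);
      \<alpha> = fst (prod_decode a5); \<beta> = snd (prod_decode a5);
      s = fst (prod_decode e); e1 = snd (prod_decode e);
      X = fst (prod_decode e1); Y = snd (prod_decode e1) in
      if cond S R n k1 k2 \<alpha> \<beta> b s X Y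
      then 2 ^ (2 * (R ^ 2) ^ 2) + X + 2 ^ (R ^ 2) ^ 2 * Y else 0)" for a b e :: nat
  have "recursive 3 (\<lambda>xs. h (xs ! 0) (xs ! 1) (xs ! 2))"
    unfolding h_def Let_def cond_def by (intro rec_intros) simp_all
  then obtain c where c: "\<And>a b j v. finite {w. \<exists>e. h a b e = Suc w} \<Longrightarrow> card {w. \<exists>e. h a b e = Suc w} \<le> 2 ^ j \<Longrightarrow>
      \<exists>e. h a b e = Suc (bstr_code v) \<Longrightarrow> real (KC U v) \<le> real j + lg b + 4 * (lg a + lg j) + c"
    using KC_describe by blast
  show ?thesis
  proof (rule that[of "c + 1"])
    fix S R n k1 k2 \<alpha> \<beta> u v w
    assume n: "S \<le> R" "R \<le> n" "n \<le> R ^ 2"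
      and len: "length u = (R ^ 2) ^ 2" "length v = (R ^ 2) ^ 2" "length w = n"
      and bits: "\<And>l. l < n \<Longrightarrow> S \<le> l \<Longrightarrow> two_blocks_bit R (str_val u) (str_val v) l = w ! l"
      and KC: "KC U u = k1" "KC U v = k2"
      and \<alpha>: "\<And>s. extensions s ((R ^ 2) ^ 2) k1 (R ^ 2) (str_val u mod 2 ^ (R ^ 2)) \<le> 2 ^ \<alpha>"
      and \<beta>: "\<And>s. extensions s ((R ^ 2) ^ 2) k2 (R ^ 2) (str_val v mod 2 ^ (R ^ 2)) \<le> 2 ^ \<beta>"
      and k: "6 * R ^ 2 \<le> k1" "6 * R ^ 2 \<le> k2" "3 * R + \<alpha> \<le> k1" "3 * R + \<beta> \<le> k2"
    define N where "N = (R ^ 2) ^ 2"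
    define a where "a = prod_encode (S, prod_encode (R, prod_encode (n, prod_encode (k1, prod_encode (k2,
        prod_encode (\<alpha>, \<beta>))))))"
    define j where "j = k1 + k2 + S + 12 - n"
    obtain p where p: "length p = KC U w" "U p = Some w"
      using KC_program by blast
    define b where "b = bstr_code p"
    obtain s0 where s0: "step s0 b = 2 ^ n + str_val w"
      using p(2) len(3) by (auto simp: U_iff b_def Suc_bstr_code)
    \<comment> \<open>The lower bound excludes the value 0 for no answer yet; any later answer is
      the code of \<open>w\<close>.\<close>
    have step_b: "step s b = 2 ^ n + str_val w" if "2 ^ n \<le> step s b" for s
    proof -
      have "0 < (2::nat) ^ n" by simp
      then have "step s b = Suc (step s b - 1)" "step s0 b = Suc (2 ^ n + str_val w - 1)"
        using that s0 by linarith+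
      from step_unique[OF this] that \<open>0 < 2 ^ n\<close> show ?thesis by linarith
    qed
    define B where "B = {X. X < 2 ^ N \<and> (\<exists>s. simple s N k1 X \<and> extensions s N k1 (R ^ 2) (X mod 2 ^ (R ^ 2)) \<le> 2 ^ \<alpha>)}"
    define C where "C = {Y. Y < 2 ^ N \<and> (\<exists>s. simple s N k2 Y \<and> extensions s N k2 (R ^ 2) (Y mod 2 ^ (R ^ 2)) \<le> 2 ^ \<beta>)}"
    define W where "W = {(X, Y) \<in> B \<times> C. \<forall>l<n. S \<le> l \<longrightarrow> two_blocks_bit R X Y l = bit (str_val w) l}"
    have h: "h a b (prod_encode (s, prod_encode (X, Y))) =
        (if cond S R n k1 k2 \<alpha> \<beta> b s X Y then 2 ^ (2 * N) + X + 2 ^ N * Y else 0)" for s X Y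
      by (simp add: h_def a_def N_def)
    have sub: "{w. \<exists>e. h a b e = Suc w} \<subseteq> (\<lambda>(X, Y). 2 ^ (2 * N) + X + 2 ^ N * Y - 1) ` W"
    proof clarify
      fix y e
      assume y: "h a b e = Suc y"
      obtain s X Y where e: "e = prod_encode (s, prod_encode (X, Y))"
        by (metis prod_decode_inverse surj_pair)
      have cond: "cond S R n k1 k2 \<alpha> \<beta> b s X Y"
        using y unfolding e h by (auto split: if_splits)
      then have "step s b = 2 ^ n + str_val w"
        by (intro step_b) (simp add: cond_def)
      then have "(X, Y) \<in> W"
        using cond unfolding cond_def W_def B_def C_def N_def by auto
      moreover have "y = 2 ^ (2 * N) + X + 2 ^ N * Y - 1"
        using y cond unfolding e h by simp
      ultimately show "y \<in> (\<lambda>(X, Y). 2 ^ (2 * N) + X + 2 ^ N * Y - 1) ` W"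
        by (intro image_eqI[of _ _ "(X, Y)"]) auto
    qed
    have finW: "finite W"
      unfolding W_def by (rule finite_subset[of _ "{..<2 ^ N} \<times> {..<2 ^ N}"]) (auto simp: B_def C_def)
    have "card B \<le> card {X. X < 2 ^ N \<and> (\<exists>s. simple s N k1 X)}"
      by (intro card_mono) (auto simp: B_def)
    then have cardB: "card B \<le> 2 ^ Suc k1"
      using card_simple by (rule order.trans)
    have "card C \<le> card {X. X < 2 ^ N \<and> (\<exists>s. simple s N k2 X)}"
      by (intro card_mono) (auto simp: C_def)
    then have cardC: "card C \<le> 2 ^ Suc k2"
      using card_simple by (rule order.trans)
    have trimB: "card {X \<in> B. X mod 2 ^ (R ^ 2) = v} \<le> 2 ^ \<alpha>" for v
      unfolding B_def by (rule card_trimmed)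
    have trimC: "card {Y \<in> C. Y mod 2 ^ (R ^ 2) = v} \<le> 2 ^ \<beta>" for v
      unfolding C_def by (rule card_trimmed)
    have "card W \<le> 2 ^ j"
      unfolding W_def j_def
    proof (rule two_level_card_bound[OF n])
      show "B \<subseteq> {..<2 ^ (R ^ 2) ^ 2}" "C \<subseteq> {..<2 ^ (R ^ 2) ^ 2}"
        by (auto simp: B_def C_def N_def)
    qed (rule cardB cardC trimB trimC k)+
    then have "card {w. \<exists>e. h a b e = Suc w} \<le> 2 ^ j"
      by (rule order.trans[OF order.trans[OF card_mono[OF finite_imageI[OF finW] sub] card_image_le[OF finW]]])
    moreover have "finite {w. \<exists>e. h a b e = Suc w}"
      using sub finW finite_surj by blast
    moreover have "\<exists>e. h a b e = Suc (bstr_code (u @ v))"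
    proof -
      obtain s1 s2 where s12: "simple s1 N k1 (str_val u)" "simple s2 N k2 (str_val v)"
        using simple_KC len KC unfolding N_def by metis
      define s where "s = s0 + s1 + s2"
      have "simple s N k1 (str_val u)" "simple s N k2 (str_val v)"
        using simple_mono[OF s12(1), of s] simple_mono[OF s12(2), of s] by (simp_all add: s_def)
      moreover have "step s b = 2 ^ n + str_val w"
        using step_mono[of s0 b "2 ^ n + str_val w - 1" s] s0 by (simp add: s_def)
      moreover have "bit (str_val w) l = w ! l" if "l < n" for l
        using that len by (simp add: bit_horner_sum_bit_iff)
      ultimately have "cond S R n k1 k2 \<alpha> \<beta> b s (str_val u) (str_val v)"
        using bits \<alpha> \<beta> str_val_less[of u] str_val_less[of v] len
        by (simp add: cond_def N_def)
      then have "h a b (prod_encode (s, prod_encode (str_val u, str_val v))) =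
          2 ^ (2 * N) + str_val u + 2 ^ N * str_val v"
        by (simp add: h)
      also have "\<dots> = Suc (bstr_code (u @ v))"
        unfolding Suc_bstr_code using len by (simp add: N_def horner_sum_append mult_2)
      finally show ?thesis by blast
    qed
    ultimately have "real (KC U (u @ v)) \<le> real j + lg b + 4 * (lg a + lg j) + c"
      by (intro c)
    moreover have "lg b \<le> real (KC U w) + 1"
      using lg_bstr_code(2)[of p] p by (simp add: b_def)
    ultimately show "real (KC U (u @ v)) \<le> real (k1 + k2 + S + 12 - n) + real (KC U w) +
      4 * (lg (prod_encode (S, prod_encode (R, prod_encode (n, prod_encode (k1, prod_encode (k2,
        prod_encode (\<alpha>, \<beta>))))))) + lg (k1 + k2 + S + 12 - n)) + (c + 1)"
      by (simp add: a_def j_def)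
  qed
qed

end

section \<open>Computing the extractor from the oracles\<close>

lemma length_prefix [simp]: "length (prefix x n) = n"
  by (simp add: prefix_def)

lemma nth_prefix [simp]: "i < n \<Longrightarrow> prefix x n ! i = x i"
  by (simp add: prefix_def)

lemma str_val_prefix_mod: "m \<le> n \<Longrightarrow> str_val (prefix x n) mod 2 ^ m = str_val (prefix x m)"
  by (simp add: take_bit_horner_sum_bit_eq prefix_def take_map flip: take_bit_eq_mod)

lemma str_val_prefix_Suc: "str_val (prefix x (Suc n)) = str_val (prefix x n) + 2 ^ n * of_bool (x n)"
  by (simp add: prefix_def horner_sum_append)

text \<open>All oracle queries are made here, by primitive recursion on the number of bits;
  afterwards only recursive functions are applied to the values of the prefixes.\<close>

lemma eval_prefix_value:
  assumes "recursive k f"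
  obtains r where "\<And>os x xs. length xs = k \<Longrightarrow> i < length os \<Longrightarrow> os ! i = seq_oracle x \<Longrightarrow>
    eval os r xs (str_val (prefix x (f xs)))"
proof -
  obtain rf where rf: "\<And>os xs. length xs = k \<Longrightarrow> eval os rf xs (f xs)"
    using assms unfolding recursive_def by blast
  have "recursive 3 (\<lambda>ys. ys ! 1 + 2 ^ (ys ! 0) * ys ! 2)"
    by (intro rec_intros) simp_all
  then obtain rg where "\<And>os ys. length ys = 3 \<Longrightarrow> eval os rg ys (ys ! 1 + 2 ^ (ys ! 0) * ys ! 2)"
    unfolding recursive_def by blast
  from this[of "[_, _, _]"] have rg: "eval os rg [n, y, b] (y + 2 ^ n * b)" for os n y b
    by simp
  \<comment> \<open>Oracles are indexed from 1, so bit \<open>m\<close> is queried at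
    \<open>Suc m\<close>.\<close>
  define step where "step = Comp rg [Proj 0, Proj 1, Comp (Oracle i) [Comp Succ [Proj 0]]]"
  have prim: "eval os (Prim Zero step) [m] (str_val (prefix x m))"
    if os: "i < length os" "os ! i = seq_oracle x" for os x m
  proof (induction m)
    case 0
    show ?case by (auto simp: prefix_def intro: eval.intros)
  next
    case (Suc m)
    let ?y = "str_val (prefix x m)"
    have p0: "eval os (Proj 0) [m, ?y] m" and p1: "eval os (Proj 1) [m, ?y] ?y"
      using eval.eval_proj[of 0 "[m, ?y]" os] eval.eval_proj[of 1 "[m, ?y]" os] by simp_all
    have "eval os (Comp Succ [Proj 0]) [m, ?y] (Suc m)"
      by (rule eval.eval_comp[of "[m]"]) (use p0 in \<open>auto intro: eval.eval_succ\<close>)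
    then have "eval os (Comp (Oracle i) [Comp Succ [Proj 0]]) [m, ?y] (of_bool (x m))"
      using eval.eval_oracle[OF os(1), of "Suc m" "[]"] os(2)
      by (intro eval.eval_comp[of "[Suc m]"]) (auto simp: seq_oracle_def bit_val_def of_bool_def)
    then have "eval os step [m, ?y] (str_val (prefix x (Suc m)))"
      unfolding step_def str_val_prefix_Suc
      by (intro eval.eval_comp[of "[m, ?y, of_bool (x m)]"] rg)
         (use p0 p1 in \<open>auto simp: nth_Cons less_Suc_eq numeral_3_eq_3 split: nat.splits\<close>)
    then show ?case
      using Suc by (rule eval.eval_primS[rotated])
  qed
  have "eval os (Comp (Prim Zero step) [rf]) xs (str_val (prefix x (f xs)))"
    if "length xs = k" "i < length os" "os ! i = seq_oracle x" for os x xs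
    by (rule eval.eval_comp[of "[f xs]"]) (use prim rf that in auto)
  then show ?thesis by (rule that)
qed

definition block_size :: "nat \<Rightarrow> nat" where
  "block_size n = 2 ^ 2 ^ (LEAST i. n < 2 ^ 2 ^ i)"

definition extractor :: "(nat \<Rightarrow> bool) \<Rightarrow> (nat \<Rightarrow> bool) \<Rightarrow> nat \<Rightarrow> bool" where
  "extractor x y n = block_bit (block_size n) (str_val (prefix x (block_size n ^ 2)))
     (str_val (prefix y (block_size n ^ 2))) n"

lemma less_double_exp: "\<exists>i. n < 2 ^ 2 ^ (i::nat)" for n :: nat
  using less_trans[OF less_exp less_exp] by blast

lemma recursive_block_size [rec_intros]:
  assumes "recursive k f"
  shows "recursive k (\<lambda>xs. block_size (f xs))"
proof (rule recursive_apply1[of block_size, OF _ assms])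
  show "recursive 1 (\<lambda>ys. block_size (ys ! 0))"
    unfolding block_size_def
    by (intro rec_intros recursive_Least[of 1 "\<lambda>i ys. ys ! 0 < 2 ^ 2 ^ i"] less_double_exp) simp_all
qed

text \<open>The number of bits to read is computed from \<open>n\<close> alone, so the term halts on
  all oracles. The input 0, which totality includes, is treated like 1 by truncated
  subtraction.\<close>

lemma extractor_computable:
  "\<exists>M. \<forall>x y t n. eval [seq_oracle x, seq_oracle y] M [t, n] (bit_val (extractor x y (n - 1)))"
proof -
  have f: "recursive 2 (\<lambda>xs. block_size (xs ! 1 - 1) ^ 2)"
    by (intro rec_intros) simp_all
  obtain r0 where r0: "\<And>os x xs. length xs = 2 \<Longrightarrow> 0 < length os \<Longrightarrow> os ! 0 = seq_oracle x \<Longrightarrow>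
      eval os r0 xs (str_val (prefix x (block_size (xs ! 1 - 1) ^ 2)))"
    using eval_prefix_value[OF f, of 0] by blast
  obtain r1 where r1: "\<And>os x xs. length xs = 2 \<Longrightarrow> 1 < length os \<Longrightarrow> os ! 1 = seq_oracle x \<Longrightarrow>
      eval os r1 xs (str_val (prefix x (block_size (xs ! 1 - 1) ^ 2)))"
    using eval_prefix_value[OF f, of 1] by blast
  have "recursive 3 (\<lambda>ys. of_bool (block_bit (block_size (ys ! 0 - 1)) (ys ! 1) (ys ! 2) (ys ! 0 - 1)))"
    by (intro rec_intros) simp_all
  then obtain g where g: "\<And>os ys. length ys = 3 \<Longrightarrow>
      eval os g ys (of_bool (block_bit (block_size (ys ! 0 - 1)) (ys ! 1) (ys ! 2) (ys ! 0 - 1)))"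
    unfolding recursive_def by blast
  have "eval [seq_oracle x, seq_oracle y] (Comp g [Proj 1, r0, r1]) [t, n] (bit_val (extractor x y (n - 1)))"
    for x y t n
  proof (rule eval.eval_comp)
    let ?os = "[seq_oracle x, seq_oracle y]"
    let ?ys = "[n, str_val (prefix x (block_size (n - 1) ^ 2)), str_val (prefix y (block_size (n - 1) ^ 2))]"
    show "eval ?os g ?ys (bit_val (extractor x y (n - 1)))"
      using g[of ?ys ?os] by (simp add: extractor_def bit_val_def of_bool_def)
    show "\<forall>i<length [Proj 1, r0, r1]. eval ?os ([Proj 1, r0, r1] ! i) [t, n] (?ys ! i)"
      using eval.eval_proj[of 1 "[t, n]" ?os] r0[of "[t, n]" ?os x] r1[of "[t, n]" ?os y]
      by (auto simp: nth_Cons less_Suc_eq split: nat.splits)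
  qed simp
  then show ?thesis by blast
qed

section \<open>Blocks around a position, and asymptotic estimates\<close>

lemma block_size_eq:
  assumes "2 ^ 2 ^ j \<le> l" "l < 2 ^ 2 ^ Suc j"
  shows "block_size l = 2 ^ 2 ^ Suc j"
proof -
  have "(LEAST i. l < 2 ^ 2 ^ i) = Suc j"
  proof (rule Least_equality)
    fix i
    assume "l < 2 ^ 2 ^ i"
    show "Suc j \<le> i"
    proof (rule ccontr)
      assume "\<not> Suc j \<le> i"
      then have "(2::nat) ^ 2 ^ i \<le> 2 ^ 2 ^ j"
        by (intro power_increasing) auto
      with assms(1) \<open>l < 2 ^ 2 ^ i\<close> show False by linarith
    qed
  qed fact
  then show ?thesis by (simp add: block_size_def)
qed

text \<open>\<open>R\<close> is the last block boundary not above \<open>n\<close>, and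
  \<open>S\<close> the one before it; \<open>4 \<le> n\<close> guarantees that \<open>S\<close>
  exists.\<close>

lemma blocks_around:
  assumes "4 \<le> n"
  obtains S R where "R = S ^ 2" "R \<le> n" "n < R ^ 2"
    "\<And>l. S \<le> l \<Longrightarrow> l < R \<Longrightarrow> block_size l = R" "\<And>l. R \<le> l \<Longrightarrow> l < R ^ 2 \<Longrightarrow> block_size l = R ^ 2"
proof -
  define i where "i = (LEAST i. n < 2 ^ 2 ^ i)"
  have i: "n < 2 ^ 2 ^ i"
    unfolding i_def by (rule LeastI_ex[OF less_double_exp])
  have "2 \<le> i"
  proof (rule ccontr)
    assume "\<not> 2 \<le> i"
    then have "(2::nat) ^ 2 ^ i \<le> 2 ^ 2 ^ 1"
      by (intro power_increasing) auto
    with i assms show False by simp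
  qed
  then obtain j where j: "i = Suc (Suc j)"
    by (auto dest: le_Suc_ex)
  have sq: "(2 ^ 2 ^ m) ^ 2 = (2::nat) ^ 2 ^ Suc m" for m
    by (simp flip: power_mult)
  show ?thesis
  proof (rule that)
    have "\<not> n < 2 ^ 2 ^ Suc j"
      using not_less_Least[of "Suc j" "\<lambda>i. n < 2 ^ 2 ^ i"] j by (simp add: i_def)
    then show "2 ^ 2 ^ Suc j \<le> n" by simp
    show "2 ^ 2 ^ Suc j = (2 ^ 2 ^ j :: nat) ^ 2"
      by (rule sq[symmetric])
    show "n < (2 ^ 2 ^ Suc j) ^ 2"
      unfolding sq using i j by simp
    show "block_size l = 2 ^ 2 ^ Suc j" if "2 ^ 2 ^ j \<le> l" "l < 2 ^ 2 ^ Suc j" for l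
      using that by (rule block_size_eq)
    show "block_size l = (2 ^ 2 ^ Suc j) ^ 2" if "2 ^ 2 ^ Suc j \<le> l" "l < (2 ^ 2 ^ Suc j) ^ 2" for l
      using that unfolding sq by (rule block_size_eq)
  qed
qed

text \<open>All parameters are polynomially bounded in \<open>R\<close>, so their descriptions cost
  \<open>O(log R)\<close>. The estimate \<open>R ^ 8 + 2 \<le> (R + 1) ^ 8\<close> follows by
  squaring three times.\<close>

lemma lg_le_poly:
  assumes "1 \<le> R" "m \<le> R ^ 8 + 1"
  shows "lg m \<le> 8 * lg R"
proof -
  have sq: "a ^ 2 + 2 \<le> b ^ 2" if "a + 2 \<le> b" for a b :: nat
    using power_mono[OF that, of 2] by (simp add: power2_eq_square algebra_simps)
  have "R ^ 2 + 2 \<le> (R + 1) ^ 2"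
    using assms(1) by (simp add: power2_eq_square)
  then have "((R ^ 2) ^ 2) ^ 2 + 2 \<le> (((R + 1) ^ 2) ^ 2) ^ 2"
    by (rule sq[OF sq])
  then have "m + 1 \<le> (R + 1) ^ 8"
    using assms(2) by (simp flip: power_mult)
  then have "real (m + 1) \<le> real ((R + 1) ^ 8)"
    by (rule of_nat_mono)
  then have "lg m \<le> log 2 ((real R + 1) ^ 8)"
    unfolding lg_def by (subst log_le_cancel_iff) (auto simp: add.commute)
  also have "\<dots> = 8 * lg R"
    by (simp add: lg_def log_nat_power)
  finally show ?thesis .
qed

context staged_universal
begin

text \<open>The prefix of length \<open>R ^ 2\<close> has complexity at least
  \<open>\<tau> * R ^ 2\<close>, which eventually exceeds \<open>3 * R + O(log R)\<close>. By
  \<open>many_extensions\<close> it cannot have too many extensions.\<close>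

lemma few_extensions:
  assumes "0 < \<tau>" "randomness_rate U \<tau> x"
  shows "\<forall>\<^sub>F R in sequentially. \<exists>\<alpha>.
    (\<forall>s. extensions s ((R ^ 2) ^ 2) (KC U (prefix x ((R ^ 2) ^ 2))) (R ^ 2)
      (str_val (prefix x ((R ^ 2) ^ 2)) mod 2 ^ (R ^ 2)) \<le> 2 ^ \<alpha>) \<and>
    3 * R + \<alpha> \<le> KC U (prefix x ((R ^ 2) ^ 2)) \<and> 6 * R ^ 2 \<le> KC U (prefix x ((R ^ 2) ^ 2)) \<and>
    KC U (prefix x ((R ^ 2) ^ 2)) \<le> R ^ 7"
proof -
  obtain c1 where c1: "\<And>N M k \<alpha> v s. length v = M \<Longrightarrow> 2 ^ \<alpha> < extensions s N k M (str_val v) \<Longrightarrow>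
    \<alpha> \<le> Suc k \<and> real (KC U v) \<le> real (Suc k - \<alpha>) +
      4 * (lg (prod_encode (N, prod_encode (M, prod_encode (k, \<alpha>)))) + lg (Suc k - \<alpha>)) + c1"
    using many_extensions by blast
  obtain c2 where c2: "\<And>v. real (KC U v) \<le> real (length v) + c2"
    using KC_le_length by blast
  obtain m0 where m0: "\<And>m. m0 \<le> m \<Longrightarrow> \<tau> * real m \<le> real (KC U (prefix x m))"
    using assms(2) unfolding randomness_rate_def eventually_sequentially by blast
  have "\<forall>\<^sub>F R::nat in sequentially. 6 * real R ^ 2 \<le> \<tau> * real R ^ 4"
    using assms(1) by real_asymp
  moreover have "\<forall>\<^sub>F R::nat in sequentially. real R ^ 4 + c2 \<le> real R ^ 7"
    by real_asymp
  \<comment> \<open>With all parameters of logarithm at most \<open>8 * lg R\<close>, the three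
    nested pairings give \<open>176 * lg R\<close>, and \<open>4 * (176 + 8) = 736\<close> is below
    800.\<close>
  moreover have "\<forall>\<^sub>F R::nat in sequentially. 3 * real R + 3 + 800 * log 2 (real R + 1) + c1 \<le> \<tau> * real R ^ 2"
    using assms(1) by real_asymp
  moreover have "\<forall>\<^sub>F R in sequentially. max m0 2 \<le> R"
    by (rule eventually_ge_at_top)
  ultimately show ?thesis
  proof eventually_elim
    case (elim R)
    define N M k where "N = (R ^ 2) ^ 2" and "M = R ^ 2" and "k = KC U (prefix x N)"
    have R: "2 \<le> R" "m0 \<le> R" using elim by auto
    have "R \<le> M" using R by (simp add: M_def power2_eq_square)
    have "M \<le> N" using R by (simp add: N_def M_def power2_eq_square)
    have N4: "N = R ^ 4" by (simp add: N_def flip: power_mult)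
    have "6 * real R ^ 2 \<le> real k"
      using elim(1) m0[of N] \<open>R \<le> M\<close> \<open>M \<le> N\<close> R by (simp add: k_def N4)
    then have k6: "6 * R ^ 2 \<le> k"
      by (metis of_nat_le_iff of_nat_mult of_nat_numeral of_nat_power)
    have "real k \<le> real R ^ 7"
      using elim(2) c2[of "prefix x N"] unfolding k_def N4 length_prefix of_nat_power by linarith
    then have k7: "k \<le> R ^ 7"
      by (metis of_nat_le_iff of_nat_power)
    have le8: "R ^ i \<le> R ^ 8" if "i \<le> 8" for i
      using R that by (intro power_increasing) auto
    define P where "P \<alpha> \<longleftrightarrow> (\<forall>s. extensions s N k M (str_val (prefix x N) mod 2 ^ M) \<le> 2 ^ \<alpha>)" for \<alpha>
    \<comment> \<open>At most \<open>2 ^ Suc k\<close> strings are simple at all, so the least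
      \<open>\<alpha>\<close> below exists.\<close>
    have "P (Suc k)"
      unfolding P_def
    proof
      fix s
      have "extensions s N k M (str_val (prefix x N) mod 2 ^ M) \<le> card {X. X < 2 ^ N \<and> (\<exists>s. simple s N k X)}"
        unfolding extensions_eq_card by (intro card_mono) auto
      then show "extensions s N k M (str_val (prefix x N) mod 2 ^ M) \<le> 2 ^ Suc k"
        using card_simple by (rule order.trans)
    qed
    define \<alpha> where "\<alpha> = (LEAST \<alpha>. P \<alpha>)"
    have "P \<alpha>"
      unfolding \<alpha>_def using \<open>P (Suc k)\<close> by (rule LeastI)
    have "3 * R + \<alpha> \<le> k"
    proof (cases \<alpha>)
      case 0
      then show ?thesis using k6 \<open>R \<le> M\<close> by (simp add: M_def)
    next
      case (Suc \<alpha>')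
      \<comment> \<open>By minimality the bound with exponent \<open>\<alpha> - 1\<close> fails at
        some stage, where \<open>many_extensions\<close> applies.\<close>
      then have "\<not> P \<alpha>'"
        using not_less_Least[of \<alpha>' P] by (simp add: \<alpha>_def)
      then obtain s where "2 ^ \<alpha>' < extensions s N k M (str_val (prefix x M))"
        using str_val_prefix_mod[OF \<open>M \<le> N\<close>, of x] by (auto simp: P_def not_le)
      from c1[OF length_prefix this] have \<alpha>': "\<alpha>' \<le> Suc k"
        and KC: "real (KC U (prefix x M)) \<le> real (Suc k - \<alpha>') +
          4 * (lg (prod_encode (N, prod_encode (M, prod_encode (k, \<alpha>')))) + lg (Suc k - \<alpha>')) + c1"
        by auto
      have "1 \<le> R" "N \<le> R ^ 8 + 1" "M \<le> R ^ 8 + 1" "k \<le> R ^ 8 + 1" "\<alpha>' \<le> R ^ 8 + 1" "Suc k - \<alpha>' \<le> R ^ 8 + 1"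
        using R le8[of 4] le8[of 2] le8[of 7] k7 \<alpha>' unfolding N4 M_def by linarith+
      then have "lg N \<le> 8 * lg R" "lg M \<le> 8 * lg R" "lg k \<le> 8 * lg R" "lg \<alpha>' \<le> 8 * lg R" "lg (Suc k - \<alpha>') \<le> 8 * lg R"
        by (simp_all add: lg_le_poly)
      then have "4 * (lg (prod_encode (N, prod_encode (M, prod_encode (k, \<alpha>')))) + lg (Suc k - \<alpha>')) \<le> 800 * lg R"
        using lg_prod_encode[of N "prod_encode (M, prod_encode (k, \<alpha>'))"]
          lg_prod_encode[of M "prod_encode (k, \<alpha>')"] lg_prod_encode[of k \<alpha>'] lg_nonneg[of R] unfolding distrib_left by linarith
      moreover have "\<tau> * real R ^ 2 \<le> real (KC U (prefix x M))"
        using m0[of M] R \<open>R \<le> M\<close> by (simp add: M_def)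
      ultimately have "3 * real R + real \<alpha> \<le> real k"
        using KC elim(3) \<alpha>' Suc unfolding lg_def by (simp add: of_nat_diff)
      then show ?thesis by linarith
    qed
    with \<open>P \<alpha>\<close> k6 k7 show ?case
      unfolding P_def N_def M_def k_def by blast
  qed
qed

text \<open>\<open>KC_pair_bound\<close> and independence bound the complexity of the same
  concatenation from above and below. The term \<open>k1 + k2\<close> cancels, and
  \<open>S \<le> sqrt n\<close> together with the logarithms is absorbed by
  \<open>\<delta> * n\<close>.\<close>

theorem randomness_rate_extractor:
  assumes "0 < \<tau>" "independent U x y" "randomness_rate U \<tau> x" "randomness_rate U \<tau> y" "0 < \<delta>"
  shows "randomness_rate U (1 - \<delta>) (extractor x y)"
proof -
  obtain c0 where c0: "\<And>n m. 1 \<le> n \<Longrightarrow> 1 \<le> m \<Longrightarrow> real (KC U (prefix x n @ prefix y m)) \<ge>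
      real (KC U (prefix x n)) + real (KC U (prefix y m)) - c0 * (1 + log 2 n + log 2 m)"
    using assms(2) unfolding independent_def by blast
  obtain c1 where c1: "\<And>S R n k1 k2 \<alpha> \<beta> u v w. S \<le> R \<Longrightarrow> R \<le> n \<Longrightarrow> n \<le> R ^ 2 \<Longrightarrow>
    length u = (R ^ 2) ^ 2 \<Longrightarrow> length v = (R ^ 2) ^ 2 \<Longrightarrow> length w = n \<Longrightarrow>
    (\<And>l. l < n \<Longrightarrow> S \<le> l \<Longrightarrow> two_blocks_bit R (str_val u) (str_val v) l = w ! l) \<Longrightarrow>
    KC U u = k1 \<Longrightarrow> KC U v = k2 \<Longrightarrow>
    (\<And>s. extensions s ((R ^ 2) ^ 2) k1 (R ^ 2) (str_val u mod 2 ^ (R ^ 2)) \<le> 2 ^ \<alpha>) \<Longrightarrow>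
    (\<And>s. extensions s ((R ^ 2) ^ 2) k2 (R ^ 2) (str_val v mod 2 ^ (R ^ 2)) \<le> 2 ^ \<beta>) \<Longrightarrow>
    6 * R ^ 2 \<le> k1 \<Longrightarrow> 6 * R ^ 2 \<le> k2 \<Longrightarrow> 3 * R + \<alpha> \<le> k1 \<Longrightarrow> 3 * R + \<beta> \<le> k2 \<Longrightarrow>
    real (KC U (u @ v)) \<le> real (k1 + k2 + S + 12 - n) + real (KC U w) +
      4 * (lg (prod_encode (S, prod_encode (R, prod_encode (n, prod_encode (k1, prod_encode (k2,
        prod_encode (\<alpha>, \<beta>))))))) + lg (k1 + k2 + S + 12 - n)) + c1"
    using KC_pair_bound by blast
  obtain R0 where R0: "\<And>R z. R0 \<le> R \<Longrightarrow> z \<in> {x, y} \<Longrightarrow> \<exists>\<alpha>.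
    (\<forall>s. extensions s ((R ^ 2) ^ 2) (KC U (prefix z ((R ^ 2) ^ 2))) (R ^ 2)
      (str_val (prefix z ((R ^ 2) ^ 2)) mod 2 ^ (R ^ 2)) \<le> 2 ^ \<alpha>) \<and>
    3 * R + \<alpha> \<le> KC U (prefix z ((R ^ 2) ^ 2)) \<and> 6 * R ^ 2 \<le> KC U (prefix z ((R ^ 2) ^ 2)) \<and>
    KC U (prefix z ((R ^ 2) ^ 2)) \<le> R ^ 7"
    using eventually_conj[OF few_extensions[OF assms(1,3)] few_extensions[OF assms(1,4)]]
    unfolding eventually_sequentially by blast
  \<comment> \<open>The parameters cost at most \<open>4 * (1555 + 8) * lg R\<close>, which is below
    \<open>7000 * lg R\<close>. Independence at the two lengths \<open>R ^ 4\<close> costs at most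
    \<open>1 + 8 * lg R\<close> times the absolute value of \<open>c0\<close>, hence the 9.\<close>
  define c where "c = 7000 + \<bar>c1\<bar> + 9 * \<bar>c0\<bar>"
  have "0 < c" by (simp add: c_def add_pos_nonneg)
  have "\<forall>\<^sub>F n::nat in sequentially. sqrt (real n) + 12 + c + c * log 2 (real n + 1) \<le> \<delta> * real n"
    using assms(5) \<open>0 < c\<close> by real_asymp
  \<comment> \<open>As \<open>n < R ^ 2\<close>, this makes \<open>R\<close> larger than
    \<open>max R0 3\<close>; the 4 is for \<open>blocks_around\<close>.\<close>
  moreover have "\<forall>\<^sub>F n in sequentially. max ((max R0 3) ^ 2) 4 \<le> n"
    by (rule eventually_ge_at_top)
  ultimately show ?thesis
    unfolding randomness_rate_def
  proof eventually_elim
    case (elim n)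
    obtain S R where R: "R = S ^ 2" "R \<le> n" "n < R ^ 2"
      and block: "\<And>l. S \<le> l \<Longrightarrow> l < R \<Longrightarrow> block_size l = R" "\<And>l. R \<le> l \<Longrightarrow> l < R ^ 2 \<Longrightarrow> block_size l = R ^ 2"
      using blocks_around[of n] elim(2) by (metis max.bounded_iff)
    have "(max R0 3) ^ 2 < R ^ 2" using elim(2) R(3) by linarith
    then have R3: "R0 \<le> R" "3 \<le> R"
      using power_less_imp_less_base[of "max R0 3" 2 R] by auto
    define N k1 k2 where "N = (R ^ 2) ^ 2" and "k1 = KC U (prefix x N)" and "k2 = KC U (prefix y N)"
    have "S \<le> R" using R(1) by (cases S) (simp_all add: power2_eq_square)
    have "R \<le> R ^ 2" using R3 by (simp add: power2_eq_square)
    have "R ^ 2 \<le> N" using R3 by (simp add: N_def power2_eq_square)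
    obtain \<alpha> where \<alpha>: "\<And>s. extensions s N k1 (R ^ 2) (str_val (prefix x N) mod 2 ^ (R ^ 2)) \<le> 2 ^ \<alpha>"
      "3 * R + \<alpha> \<le> k1" "6 * R ^ 2 \<le> k1" "k1 \<le> R ^ 7"
      using R0[OF R3(1), of x] unfolding N_def k1_def by blast
    obtain \<beta> where \<beta>: "\<And>s. extensions s N k2 (R ^ 2) (str_val (prefix y N) mod 2 ^ (R ^ 2)) \<le> 2 ^ \<beta>"
      "3 * R + \<beta> \<le> k2" "6 * R ^ 2 \<le> k2" "k2 \<le> R ^ 7"
      using R0[OF R3(1), of y] unfolding N_def k2_def by blast
    \<comment> \<open>Below \<open>R\<close> the extractor reads the prefixes of length
      \<open>R ^ 2\<close> only, and these are recovered by reduction modulo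
      \<open>2 ^ (R ^ 2)\<close>.\<close>
    have bits: "two_blocks_bit R (str_val (prefix x N)) (str_val (prefix y N)) l = prefix (extractor x y) n ! l"
      if "l < n" "S \<le> l" for l
    proof (cases "l < R")
      case True
      then show ?thesis
        using block(1)[OF that(2) True] that \<open>R ^ 2 \<le> N\<close>
        by (simp add: two_blocks_bit_def extractor_def str_val_prefix_mod)
    next
      case False
      then show ?thesis
        using block(2)[of l] R(3) that by (simp add: two_blocks_bit_def extractor_def N_def)
    qed
    define a where "a = prod_encode (S, prod_encode (R, prod_encode (n, prod_encode (k1, prod_encode (k2,
        prod_encode (\<alpha>, \<beta>))))))"
    define j where "j = k1 + k2 + S + 12 - n"
    have upper: "real (KC U (prefix x N @ prefix y N)) \<le>
        real j + real (KC U (prefix (extractor x y) n)) + 4 * (lg a + lg j) + c1"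
      unfolding a_def j_def
    proof (rule c1[OF \<open>S \<le> R\<close> R(2) less_imp_le[OF R(3)]])
      show "length (prefix x N) = (R ^ 2) ^ 2" "length (prefix y N) = (R ^ 2) ^ 2"
        by (simp_all add: N_def)
      show "KC U (prefix x N) = k1" "KC U (prefix y N) = k2"
        by (simp_all add: k1_def k2_def)
    qed (use bits \<alpha> \<beta> in \<open>simp_all add: N_def\<close>)
    have "R ^ 7 * 3 \<le> R ^ 7 * R"
      using R3 by (intro mult_le_mono) auto
    then have "3 * R ^ 7 \<le> R ^ 8"
      by (simp flip: power_Suc2)
    moreover have "R + 12 \<le> R ^ 7"
    proof -
      have "R * 3 ^ 6 \<le> R * R ^ 6"
        using R3 by (intro mult_le_mono power_mono) auto
      then show ?thesis using R3 by (simp flip: power_Suc)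
    qed
    moreover have "R ^ 2 \<le> R ^ 7"
      using R3 by (intro power_increasing) auto
    ultimately have "k1 + k2 + S + 12 \<le> R ^ 8 + 1" "R \<le> R ^ 8" "R ^ 2 \<le> R ^ 8"
      using \<alpha>(4) \<beta>(4) \<open>S \<le> R\<close> by linarith+
    then have le8: "S \<le> R ^ 8 + 1" "R \<le> R ^ 8 + 1" "n \<le> R ^ 8 + 1" "k1 \<le> R ^ 8 + 1" "k2 \<le> R ^ 8 + 1"
      "\<alpha> \<le> R ^ 8 + 1" "\<beta> \<le> R ^ 8 + 1" "j \<le> R ^ 8 + 1"
      using \<open>S \<le> R\<close> R \<alpha> \<beta> by (simp_all add: j_def)
    have "lg S \<le> 8 * lg R" "lg n \<le> 8 * lg R" "lg k1 \<le> 8 * lg R" "lg k2 \<le> 8 * lg R"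
      "lg \<alpha> \<le> 8 * lg R" "lg \<beta> \<le> 8 * lg R" "lg j \<le> 8 * lg R"
      using le8 R3 by (auto intro: lg_le_poly)
    note lgs = this lg_nonneg[of R]
    \<comment> \<open>Each pairing doubles the previous bound and adds twice the new logarithm, at
      most \<open>16 * lg R\<close>; the constants are rounded up by one.\<close>
    have "lg (prod_encode (\<alpha>, \<beta>)) \<le> 33 * lg R"
      using lg_prod_encode[of \<alpha> \<beta>] lgs by linarith
    then have "lg (prod_encode (k2, prod_encode (\<alpha>, \<beta>))) \<le> 83 * lg R"
      using lg_prod_encode[of k2 "prod_encode (\<alpha>, \<beta>)"] lgs by linarith
    then have "lg (prod_encode (k1, prod_encode (k2, prod_encode (\<alpha>, \<beta>)))) \<le> 183 * lg R"
      using lg_prod_encode[of k1 "prod_encode (k2, prod_encode (\<alpha>, \<beta>))"] lgs by linarith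
    then have "lg (prod_encode (n, prod_encode (k1, prod_encode (k2, prod_encode (\<alpha>, \<beta>))))) \<le> 383 * lg R"
      using lg_prod_encode[of n "prod_encode (k1, prod_encode (k2, prod_encode (\<alpha>, \<beta>)))"] lgs by linarith
    then have "lg (prod_encode (R, prod_encode (n, prod_encode (k1, prod_encode (k2, prod_encode (\<alpha>, \<beta>)))))) \<le> 769 * lg R"
      using lg_prod_encode[of R "prod_encode (n, prod_encode (k1, prod_encode (k2, prod_encode (\<alpha>, \<beta>))))"] lgs
      by linarith
    then have "lg a \<le> 1555 * lg R"
      unfolding a_def
      using lg_prod_encode[of S "prod_encode (R, prod_encode (n, prod_encode (k1, prod_encode (k2, prod_encode (\<alpha>, \<beta>)))))"] lgs
      by linarith
    then have "4 * (lg a + lg j) \<le> 7000 * lg R"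
      using lgs unfolding distrib_left by linarith
    moreover have "real k1 + real k2 - \<bar>c0\<bar> * (1 + 8 * lg R) \<le> real (KC U (prefix x N @ prefix y N))"
    proof -
      have "N = R ^ 4" by (simp add: N_def flip: power_mult)
      have "1 \<le> N" using R3 by (simp add: N_def)
      have "log 2 N = 4 * log 2 R"
        using R3 by (simp add: \<open>N = R ^ 4\<close> log_nat_power)
      moreover have "log 2 R \<le> lg R" "0 \<le> log 2 R"
        using R3 by (simp_all add: lg_def)
      ultimately have "c0 * (1 + log 2 N + log 2 N) \<le> \<bar>c0\<bar> * (1 + 8 * lg R)"
        by (intro mult_mono) auto
      then show ?thesis
        using c0[OF \<open>1 \<le> N\<close> \<open>1 \<le> N\<close>] by (simp add: k1_def k2_def)
    qed
    moreover have "real j = real k1 + real k2 + real S + 12 - real n"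
      using R(3) \<alpha>(3) by (simp add: j_def of_nat_diff)
    moreover have "real S \<le> sqrt (real n)"
      using R(1,2) by (intro real_le_rsqrt) (metis of_nat_le_iff of_nat_power)
    moreover have "lg R \<le> log 2 (real n + 1)"
      using lg_mono[OF R(2)] by (simp add: lg_def)
    then have "c * lg R \<le> c * log 2 (real n + 1)"
      using \<open>0 < c\<close> by simp
    moreover have "7000 * lg R + \<bar>c0\<bar> * (1 + 8 * lg R) + c1 \<le> c + c * lg R"
    proof -
      have "\<bar>c0\<bar> * (1 + 8 * lg R) = \<bar>c0\<bar> + 8 * (\<bar>c0\<bar> * lg R)"
        "c * lg R = 7000 * lg R + \<bar>c1\<bar> * lg R + 9 * (\<bar>c0\<bar> * lg R)"
        by (simp_all add: c_def algebra_simps)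
      moreover have "0 \<le> \<bar>c0\<bar> * lg R" "0 \<le> \<bar>c1\<bar> * lg R" by simp_all
      ultimately show ?thesis
        using abs_ge_self[of c1] abs_ge_zero[of c0] unfolding c_def by linarith
    qed
    ultimately show ?case
      using upper elim(1) by (simp add: algebra_simps)
  qed
qed

end

theorem theorem1p1:
  assumes "universal_machine U"
  shows "\<exists>M. truth_table M \<and>
    (\<forall>\<tau> x y. 0 < \<tau> \<and> \<tau> \<le> 1 \<longrightarrow> independent U x y \<longrightarrow>
       randomness_rate U (real_of_rat \<tau>) x \<longrightarrow> randomness_rate U (real_of_rat \<tau>) y \<longrightarrow>
       (\<exists>z. transforms M \<tau> x y z \<and> (\<forall>\<delta>::real. \<delta> > 0 \<longrightarrow> randomness_rate U (1 - \<delta>) z)))"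
proof -
  obtain step where "staged_universal U step"
    using staged_universal_exists[OF assms] .
  then interpret staged_universal U step .
  obtain M where M: "\<And>x y t n. eval [seq_oracle x, seq_oracle y] M [t, n] (bit_val (extractor x y (n - 1)))"
    using extractor_computable by blast
  then have "truth_table M"
    unfolding truth_table_def by blast
  moreover have "transforms M \<tau> x y (extractor x y)" for \<tau> x y
    unfolding transforms_def using M by blast
  moreover have "randomness_rate U (1 - \<delta>) (extractor x y)"
    if "0 < \<tau>" "independent U x y" "randomness_rate U (real_of_rat \<tau>) x" "randomness_rate U (real_of_rat \<tau>) y" "0 < \<delta>"
    for \<tau> x y \<delta>
    using that by (intro randomness_rate_extractor[of "real_of_rat \<tau>"]) simp_all
  ultimately show ?thesis by blast
qed

end
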